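(* Any finite nilpotent group is isomorphic to a subgroup of a nilpotent IYB group.
   Context: $\mathrm{Fa}_n$ is the free abelian group (written multiplicatively) with basis $u_1,\dots,u_n$, and $\mathrm{Fa}_n\rtimes \mathrm{Sym}_n$ is the semidirect product for the natural action $\sigma(u_i)=u_{\sigma(i)}$, where $\mathrm{Sym}_n$ is the symmetric group of degree $n$. A finite group $G$ is an involutive Yang-Baxter (IYB) group if for some positive integer $n$ there is a map $\phi:\mathrm{Fa}_n\to \mathrm{Sym}_n$ such that $\{(a,\phi(a)) : a\in \mathrm{Fa}_n\}$ is a subgroup of $\mathrm{Fa}_n\rtimes \mathrm{Sym}_n$ and $G\cong\phi(\mathrm{Fa}_n)$. *)

theory Defs
  imports "HOL-Algebra.Free_Abelian_Groups" "HOL-Algebra.Sym_Groups"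
begin

primrec lower_central_series :: "('a, 'b) monoid_scheme \<Rightarrow> nat \<Rightarrow> 'a set" where
  "lower_central_series G 0 = carrier G"
| "lower_central_series G (Suc k) =
     generate G (\<Union>x \<in> lower_central_series G k. \<Union>y \<in> carrier G.
       { x \<otimes>\<^bsub>G\<^esub> y \<otimes>\<^bsub>G\<^esub> inv\<^bsub>G\<^esub> x \<otimes>\<^bsub>G\<^esub> inv\<^bsub>G\<^esub> y })"

definition nilpotent_group :: "('a, 'b) monoid_scheme \<Rightarrow> bool" where
  "nilpotent_group G \<longleftrightarrow> group G \<and> (\<exists>c. lower_central_series G c = {\<one>\<^bsub>G\<^esub>})"

definition semidirect_product ::
  "('a, 'c) monoid_scheme \<Rightarrow> ('b, 'd) monoid_scheme \<Rightarrow> ('b \<Rightarrow> 'a \<Rightarrow> 'a) \<Rightarrow> ('a \<times> 'b) monoid" where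
  "semidirect_product N H \<alpha> =
     \<lparr> carrier = carrier N \<times> carrier H,
       monoid.mult = (\<lambda>(a, \<sigma>) (b, \<tau>). (a \<otimes>\<^bsub>N\<^esub> \<alpha> \<sigma> b, \<sigma> \<otimes>\<^bsub>H\<^esub> \<tau>)),
       one = (\<one>\<^bsub>N\<^esub>, \<one>\<^bsub>H\<^esub>) \<rparr>"

text \<open>The basis element \<open>u\<^sub>i\<close> is \<open>frag_of i\<close>. The elements are finitely supported functions
  \<open>nat \<Rightarrow>\<^sub>0 int\<close>, whose pointwise \<open>+\<close> is the multiplication of the group.\<close>

abbreviation Fa :: "nat \<Rightarrow> (nat \<Rightarrow>\<^sub>0 int) monoid" where
  "Fa n \<equiv> free_Abelian_group {1..n}"

text \<open>The endomorphism determined by \<open>u\<^sub>i \<mapsto> u\<^bsub>\<sigma>(i)\<^esub>\<close>.\<close>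

definition perm_action :: "(nat \<Rightarrow> nat) \<Rightarrow> (nat \<Rightarrow>\<^sub>0 int) \<Rightarrow> (nat \<Rightarrow>\<^sub>0 int)" where
  "perm_action \<sigma> = frag_extend (\<lambda>i. frag_of (\<sigma> i))"

definition Fa_Sym :: "nat \<Rightarrow> ((nat \<Rightarrow>\<^sub>0 int) \<times> (nat \<Rightarrow> nat)) monoid" where
  "Fa_Sym n = semidirect_product (Fa n) (sym_group n) perm_action"

definition IYB_group :: "('a, 'b) monoid_scheme \<Rightarrow> bool" where
  "IYB_group G \<longleftrightarrow> group G \<and> finite (carrier G) \<and>
     (\<exists>n>0. \<exists>\<phi> \<in> carrier (Fa n) \<rightarrow> carrier (sym_group n).
        subgroup {(a, \<phi> a) | a. a \<in> carrier (Fa n)} (Fa_Sym n) \<and>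
        G \<cong> (sym_group n)\<lparr>carrier := \<phi> ` carrier (Fa n)\<rparr>)"

lemma perm_action_comp: "perm_action \<sigma> (perm_action \<tau> a) = perm_action (\<sigma> \<circ> \<tau>) a"
  by (induction a rule: frag_induction [OF subset_UNIV])
    (auto simp: perm_action_def frag_extend_diff)

lemma perm_action_id: "perm_action id a = a"
  by (induction a rule: frag_induction [OF subset_UNIV])
    (auto simp: perm_action_def frag_extend_diff)

lemma perm_action_add: "perm_action \<sigma> (a + b) = perm_action \<sigma> a + perm_action \<sigma> b"
  by (simp add: perm_action_def frag_extend_add)

lemma perm_action_closed:
  assumes "\<sigma> permutes {1..n}" "a \<in> carrier (Fa n)"
  shows "perm_action \<sigma> a \<in> carrier (Fa n)"
proof -
  have "Poly_Mapping.keys (perm_action \<sigma> a) \<subseteq> \<sigma> ` Poly_Mapping.keys a"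
    unfolding perm_action_def
    by (rule order_trans [OF keys_frag_extend]) auto
  also have "\<dots> \<subseteq> \<sigma> ` {1..n}"
    using assms by (auto simp: free_Abelian_group_def)
  also have "\<dots> = {1..n}"
    using assms(1) by (rule permutes_image)
  finally show ?thesis by (simp add: free_Abelian_group_def)
qed

lemma group_Fa_Sym: "group (Fa_Sym n)"
proof (rule groupI)
  show "\<exists>y\<in>carrier (Fa_Sym n). y \<otimes>\<^bsub>Fa_Sym n\<^esub> x = \<one>\<^bsub>Fa_Sym n\<^esub>"
    if x_in: "x \<in> carrier (Fa_Sym n)" for x
  proof -
    obtain a \<sigma> where x: "x = (a, \<sigma>)" "a \<in> carrier (Fa n)" "\<sigma> permutes {1..n}"
      using x_in by (cases x) (auto simp: Fa_Sym_def semidirect_product_def sym_group_def simp del: One_nat_def)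
    let ?\<rho> = "inv' \<sigma>"
    have inv: "?\<rho> permutes {1..n}" "?\<rho> \<circ> \<sigma> = id"
      using x(3) by (auto simp: permutes_inv permutes_inv_o)
    have "- perm_action ?\<rho> a \<in> carrier (Fa n)"
      using perm_action_closed [OF inv(1) x(2)] by (simp add: free_Abelian_group_def)
    then show ?thesis using x(1) inv
      by (intro bexI [of _ "(- perm_action ?\<rho> a, ?\<rho>)"])
        (auto simp: Fa_Sym_def semidirect_product_def sym_group_def free_Abelian_group_def
           simp del: One_nat_def)
  qed
next
  fix x y
  assume "x \<in> carrier (Fa_Sym n)" "y \<in> carrier (Fa_Sym n)"
  then obtain a \<sigma> b \<tau> where xy: "x = (a, \<sigma>)" "y = (b, \<tau>)"
    and 1: "a \<in> carrier (Fa n)" "\<sigma> permutes {1..n}" "b \<in> carrier (Fa n)" "\<tau> permutes {1..n}"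
    by (cases x; cases y) (auto simp: Fa_Sym_def semidirect_product_def sym_group_def simp del: One_nat_def)
  have "a \<otimes>\<^bsub>Fa n\<^esub> perm_action \<sigma> b \<in> carrier (Fa n)"
    using group.is_monoid [OF group_free_Abelian_group] 1 perm_action_closed
    by (blast intro: monoid.m_closed)
  with 1 show "x \<otimes>\<^bsub>Fa_Sym n\<^esub> y \<in> carrier (Fa_Sym n)"
    by (auto simp: xy Fa_Sym_def semidirect_product_def sym_group_def permutes_compose
        simp del: One_nat_def carrier_free_Abelian_group_iff mult_free_Abelian_group)
qed (auto simp: Fa_Sym_def semidirect_product_def sym_group_def free_Abelian_group_def permutes_id
     perm_action_id perm_action_comp perm_action_add add.assoc o_assoc)

end

theory Submission
  imports
    Defs
    "HOL-Algebra.Multiplicative_Group"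
    "HOL-Computational_Algebra.Primes"
    "HOL-Library.Function_Algebras"
begin

text \<open>Let \<open>R\<close> be a finite nilpotent ring without unit. The operation \<open>x \<odot> y = x + y + x \<cdot> y\<close>
turns \<open>R\<close> into a group, the adjoint group, which is a model of \<open>1 + R\<close>. Since left translations
for \<open>\<odot>\<close> are affine for \<open>+\<close>, the pair \<open>(+, \<odot>)\<close> is a left brace, and the multiplicative group
of a finite brace is an IYB group (\<open>left_brace.IYB_copy\<close>). Moreover the adjoint group is
nilpotent, because a commutator of an element of the \<open>k\<close>-th power of \<open>R\<close> lies in the next power
(\<open>nilpotent_ring.nilpotent_adj\<close>). So it suffices to embed a finite nilpotent group \<open>G\<close> into the
adjoint group of a finite nilpotent ring.

For a \<open>p\<close>-group the augmentation ideal of the group algebra over the field with \<open>p\<close> elements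
would do. To treat all primes at once without decomposing \<open>G\<close> into Sylow subgroups, consider the
functions \<open>f\<close> from \<open>G\<close> to the rationals modulo the integers whose values are killed by the order
of \<open>G\<close>. Translation by \<open>g\<close> acts on them, and \<open>f\<close> is called polynomial if all \<open>k\<close>-fold
differences, formed with the operators ``translation by \<open>g\<close> minus identity'', vanish for some \<open>k\<close>.
The polynomial functions form a finite abelian group filtered by degree, the endomorphisms that
lower the degree form a nilpotent ring (\<open>filtered_group.nilpotent_ring_lowering\<close>), and
sending \<open>g\<close> to its difference operator is a homomorphism into the adjoint group of this ring. It is
injective if polynomial functions detect every \<open>g \<noteq> \<one>\<close>.

This is where nilpotency of \<open>G\<close> enters (\<open>group.polynomials_separate\<close>). Given \<open>g \<noteq> \<one>\<close>, let \<open>N\<close> be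
a normal subgroup maximal among those not containing \<open>g\<close>. Then there is one prime power \<open>q = p ^ k\<close>
such that \<open>q\<close>-th powers descend the upper central series of \<open>G\<close> relative to \<open>N\<close>
(\<open>group.ex_prime_power_section\<close>). On \<open>p\<close>-torsion functions invariant under the lower term of the
series the difference operator of an element \<open>z\<close> of the upper term is nilpotent by the Frobenius
identity \<open>(T - 1) ^ q = T ^ q - 1\<close>, and it commutes with all translations; so descending the series
from \<open>G\<close> to \<open>N\<close>, one element \<open>z\<close> at a time, every \<open>N\<close>-invariant \<open>p\<close>-torsion function is seen to
be polynomial (\<open>group.invariants_section_polynomial\<close>). A nonzero multiple of the indicator function of
\<open>N\<close> is such a function, and it distinguishes \<open>g\<close> from \<open>\<one>\<close>.\<close>

section \<open>Commutators and nilpotent groups\<close>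

context group
begin

abbreviation commutator :: "'a \<Rightarrow> 'a \<Rightarrow> 'a" where
  "commutator x y \<equiv> x \<otimes> y \<otimes> inv x \<otimes> inv y"

lemma inv_mult_cancel:
  assumes "x \<in> carrier G" "y \<in> carrier G"
  shows "inv x \<otimes> (x \<otimes> y) = y" "x \<otimes> (inv x \<otimes> y) = y"
  using assms by (simp_all flip: m_assoc)

lemmas group_word_simps = m_assoc inv_mult_group inv_mult_cancel

lemma commutator_mult:
  assumes "x \<in> carrier G" "y \<in> carrier G"
  shows "commutator x y \<otimes> (y \<otimes> x) = x \<otimes> y"
  using assms by (simp add: group_word_simps)

lemma commute_up_to_commutator:
  assumes "x \<in> carrier G" "y \<in> carrier G"
  shows "y \<otimes> x = x \<otimes> y \<otimes> commutator (inv y) (inv x)"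
  using assms by (simp add: group_word_simps)

text \<open>If the commutator commutes with \<open>x\<close>, then taking commutators with \<open>y\<close> is multiplicative on powers of \<open>x\<close>.\<close>

lemma commutator_pow:
  assumes x: "x \<in> carrier G" and y: "y \<in> carrier G"
    and comm: "commutator x y \<otimes> x = x \<otimes> commutator x y"
  shows "commutator (x [^] (m::nat)) y = commutator x y [^] m"
proof (induction m)
  case (Suc m)
  let ?c = "commutator x y"
  have c: "?c \<in> carrier G" using x y by simp
  have cm: "?c [^] m \<in> carrier G" using c by simp
  have "?c [^] m \<otimes> x = x \<otimes> ?c [^] m"
    by (rule group_commutes_pow[OF comm c x])
  have "commutator (x [^] Suc m) y = x \<otimes> commutator (x [^] m) y \<otimes> inv x \<otimes> ?c"
    using x y by (simp only: nat_pow_Suc2) (simp add: group_word_simps)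
  also have "\<dots> = ?c [^] m \<otimes> ?c"
    unfolding Suc \<open>?c [^] m \<otimes> x = x \<otimes> ?c [^] m\<close>[symmetric] using x cm c by (simp add: m_assoc)
  finally show ?case by simp
qed (use y in simp)

end

lemma lower_central_series_subset:
  assumes "group G"
  shows "lower_central_series G k \<subseteq> carrier G"
proof -
  interpret group G by fact
  show ?thesis
  proof (induction k)
    case (Suc k)
    then show ?case
      unfolding lower_central_series.simps by (intro generate_incl) auto
  qed simp
qed

text \<open>Any descending central chain of subgroups lies above the lower central series term by term. So
nilpotency follows from a chain that is convenient to compute with.\<close>

lemma nilpotent_group_if_central_chain:
  assumes G: "group G"
    and sub: "\<And>k. subgroup (\<Gamma> k) G"
    and top: "\<Gamma> 0 = carrier G" and bot: "\<Gamma> c = {\<one>\<^bsub>G\<^esub>}"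
    and comm: "\<And>k x y. x \<in> \<Gamma> k \<Longrightarrow> y \<in> carrier G \<Longrightarrow>
      x \<otimes>\<^bsub>G\<^esub> y \<otimes>\<^bsub>G\<^esub> inv\<^bsub>G\<^esub> x \<otimes>\<^bsub>G\<^esub> inv\<^bsub>G\<^esub> y \<in> \<Gamma> (Suc k)"
  shows "nilpotent_group G"
proof -
  interpret group G by fact
  have "lower_central_series G k \<subseteq> \<Gamma> k" for k
  proof (induction k)
    case (Suc k)
    then show ?case
      unfolding lower_central_series.simps
      by (intro generate_subgroup_incl[OF _ sub]) (use comm in blast)
  qed (simp add: top)
  moreover have "\<one>\<^bsub>G\<^esub> \<in> lower_central_series G k" for k
    by (cases k) (auto intro: generate.one)
  ultimately have "lower_central_series G c = {\<one>\<^bsub>G\<^esub>}"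
    using bot by blast
  then show ?thesis using G by (auto simp: nilpotent_group_def)
qed

lemma nilpotent_group_iso:
  assumes h: "h \<in> iso G H" and G: "nilpotent_group G" and H: "group H"
  shows "nilpotent_group H"
proof -
  interpret h: group_hom G H h
    using assms by (auto simp: group_hom_def group_hom_axioms_def nilpotent_group_def iso_def)
  have surj: "h ` carrier G = carrier H" using h by (auto simp: iso_def bij_betw_def)
  have "lower_central_series H k = h ` lower_central_series G k" for k
  proof (induction k)
    case (Suc k)
    define C where "C = (\<lambda>x y. x \<otimes>\<^bsub>G\<^esub> y \<otimes>\<^bsub>G\<^esub> inv\<^bsub>G\<^esub> x \<otimes>\<^bsub>G\<^esub> inv\<^bsub>G\<^esub> y)"
    define C' where "C' = (\<lambda>x y. x \<otimes>\<^bsub>H\<^esub> y \<otimes>\<^bsub>H\<^esub> inv\<^bsub>H\<^esub> x \<otimes>\<^bsub>H\<^esub> inv\<^bsub>H\<^esub> y)"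
    let ?L = "lower_central_series G k"
    have L: "?L \<subseteq> carrier G" by (rule lower_central_series_subset) (rule h.G.is_group)
    have hC: "C' (h x) (h y) = h (C x y)" if "x \<in> ?L" "y \<in> carrier G" for x y
      using that L by (auto simp: C_def C'_def subset_iff)
    have "(\<Union>x\<in>lower_central_series H k. \<Union>y\<in>carrier H. {C' x y}) =
      (\<Union>x\<in>?L. \<Union>y\<in>carrier G. {C' (h x) (h y)})"
      unfolding Suc surj[symmetric] by blast
    also have "\<dots> = h ` (\<Union>x\<in>?L. \<Union>y\<in>carrier G. {C x y})"
      using hC by (auto simp: image_UN)
    finally have img: "(\<Union>x\<in>lower_central_series H k. \<Union>y\<in>carrier H. {C' x y}) =
      h ` (\<Union>x\<in>?L. \<Union>y\<in>carrier G. {C x y})" .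
    have "(\<Union>x\<in>?L. \<Union>y\<in>carrier G. {C x y}) \<subseteq> carrier G"
      using L by (auto simp: C_def)
    from h.generate_img[OF this]
    have "generate H (\<Union>x\<in>lower_central_series H k. \<Union>y\<in>carrier H. {C' x y}) =
      h ` generate G (\<Union>x\<in>?L. \<Union>y\<in>carrier G. {C x y})"
      unfolding img by simp
    then show ?case by (simp add: C_def C'_def)
  qed (simp add: surj)
  moreover obtain c where "lower_central_series G c = {\<one>\<^bsub>G\<^esub>}"
    using G by (auto simp: nilpotent_group_def)
  ultimately have "lower_central_series H c = {\<one>\<^bsub>H\<^esub>}" by simp
  then show ?thesis using H by (auto simp: nilpotent_group_def)
qed

section \<open>Braces and involutive Yang-Baxter groups\<close>

text \<open>A left brace on a subset \<open>A\<close> of an additive group: two group structures with the same neutral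
element, linked by the law that makes \<open>y \<mapsto> x \<circ>\<^sub>A y - x\<close> additive. The second
group then acts on the first by these maps, and the identity is a bijective 1-cocycle.\<close>

locale left_brace =
  fixes A :: "'r::ab_group_add set" and circ :: "'r \<Rightarrow> 'r \<Rightarrow> 'r" (infixl "\<circ>\<^sub>A" 70)
  assumes zero: "0 \<in> A"
    and add: "\<And>x y. x \<in> A \<Longrightarrow> y \<in> A \<Longrightarrow> x + y \<in> A"
    and uminus: "\<And>x. x \<in> A \<Longrightarrow> - x \<in> A"
    and circ_group: "group \<lparr>carrier = A, monoid.mult = (\<circ>\<^sub>A), one = 0\<rparr>"
    and circ_add: "\<And>x y z. x \<in> A \<Longrightarrow> y \<in> A \<Longrightarrow> z \<in> A \<Longrightarrow> x \<circ>\<^sub>A (y + z) + x = x \<circ>\<^sub>A y + x \<circ>\<^sub>A z"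
begin

definition circ_grp :: "'r monoid" where
  "circ_grp = \<lparr>carrier = A, monoid.mult = (\<circ>\<^sub>A), one = 0\<rparr>"

text \<open>The map commonly written \<open>\<lambda>\<^sub>x\<close> in the theory of braces.\<close>

definition lam :: "'r \<Rightarrow> 'r \<Rightarrow> 'r" where
  "lam x y = x \<circ>\<^sub>A y - x"

sublocale C: group circ_grp
  rewrites "carrier circ_grp = A" and "monoid.mult circ_grp = (\<circ>\<^sub>A)" and "one circ_grp = 0"
  using circ_group by (simp_all add: circ_grp_def)

lemma diff: "x \<in> A \<Longrightarrow> y \<in> A \<Longrightarrow> x - y \<in> A"
  using add[of x "- y"] uminus by simp

lemma lam_closed: "x \<in> A \<Longrightarrow> y \<in> A \<Longrightarrow> lam x y \<in> A"
  by (simp add: lam_def diff)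

lemma lam_add: "x \<in> A \<Longrightarrow> y \<in> A \<Longrightarrow> z \<in> A \<Longrightarrow> lam x (y + z) = lam x y + lam x z"
  using circ_add[of x y z] by (simp add: lam_def algebra_simps)

lemma lam_diff: "x \<in> A \<Longrightarrow> y \<in> A \<Longrightarrow> z \<in> A \<Longrightarrow> lam x (y - z) = lam x y - lam x z"
  using lam_add[of x "y - z" z] by (simp add: diff)

lemma circ_eq: "x \<circ>\<^sub>A y = x + lam x y"
  by (simp add: lam_def)

lemma lam_circ:
  assumes "x \<in> A" "y \<in> A" "z \<in> A"
  shows "lam (x \<circ>\<^sub>A y) z = lam x (lam y z)"
proof -
  have "lam x (lam y z) = lam x (y \<circ>\<^sub>A z) - lam x y"
    using assms by (simp add: lam_def[of y] lam_diff)
  also have "\<dots> = lam (x \<circ>\<^sub>A y) z"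
    using assms by (simp add: lam_def C.m_assoc)
  finally show ?thesis by simp
qed

lemma lam_zero: "y \<in> A \<Longrightarrow> lam 0 y = y"
  by (simp add: lam_def)

lemma lam_of_zero: "x \<in> A \<Longrightarrow> lam x 0 = 0"
  using lam_add[of x 0 0] zero by simp

lemma add_group: "comm_group \<lparr>carrier = A, monoid.mult = (+), one = 0\<rparr>"
  by (rule comm_groupI) (auto simp: zero add algebra_simps intro: bexI[of _ "- x" for x] uminus)

text \<open>The action of the group \<open>(A, \<circ>\<^sub>A)\<close> on the abelian group need not be faithful. Pairing it with the
regular action repairs this, and the first projection \<open>A \<times> A \<rightarrow> A\<close> remains equivariant.\<close>

definition pair_action :: "'r \<Rightarrow> 'r \<times> 'r \<Rightarrow> 'r \<times> 'r" where
  "pair_action x = (\<lambda>(y, z). (lam x y, x \<circ>\<^sub>A z))"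

lemma pair_action_in: "x \<in> A \<Longrightarrow> w \<in> A \<times> A \<Longrightarrow> pair_action x w \<in> A \<times> A"
  by (auto simp: pair_action_def lam_closed)

lemma pair_action_circ: "x \<in> A \<Longrightarrow> y \<in> A \<Longrightarrow> w \<in> A \<times> A \<Longrightarrow> pair_action (x \<circ>\<^sub>A y) w = pair_action x (pair_action y w)"
  by (auto simp: pair_action_def lam_circ C.m_assoc)

lemma pair_action_zero: "w \<in> A \<times> A \<Longrightarrow> pair_action 0 w = w"
  by (auto simp: pair_action_def lam_zero)

lemma fst_pair_action: "fst (pair_action x w) = lam x (fst w)"
  by (simp add: pair_action_def split: prod.split)

text \<open>Number the elements of \<open>A \<times> A\<close> from \<open>1\<close> to \<open>n\<close>. The first projection extends to an equivariant
homomorphism \<open>psi\<close> from the free abelian group onto \<open>A\<close>; let \<open>phi a\<close> be the permutation by which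
\<open>psi a\<close>, read as an element of the group \<open>(A, \<circ>\<^sub>A)\<close>, acts. Because \<open>x \<circ>\<^sub>A y = x + lam x y\<close>, the product
\<open>phi a \<circ> phi b\<close> is \<open>phi\<close> of \<open>a\<close> plus the image of \<open>b\<close> under \<open>phi a\<close>, which says that the graph of
\<open>phi\<close> is closed under the multiplication of the semidirect product.\<close>

lemma IYB_copy:
  assumes fin: "finite A"
  obtains H :: "(nat \<Rightarrow> nat) monoid" and h where "IYB_group H" "h \<in> iso circ_grp H"
proof -
  define n where "n = card (A \<times> A)"
  have n: "n > 0" using fin zero by (auto simp: n_def card_gt_0_iff)
  obtain e where e: "bij_betw e {1..n} (A \<times> A)"
    using ex_bij_betw_nat_finite_1[of "A \<times> A"] fin by (auto simp: n_def)
  define e' where "e' = inv_into {1..n} e"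
  have e_in: "e i \<in> A \<times> A" if "i \<in> {1..n}" for i
    using e that unfolding bij_betw_def by blast
  have e'_in: "e' w \<in> {1..n}" and e_e': "e (e' w) = w" if "w \<in> A \<times> A" for w
    using e that unfolding e'_def bij_betw_def by (metis inv_into_into, metis f_inv_into_f)
  have e'_e: "e' (e i) = i" if "i \<in> {1..n}" for i
    using e that unfolding e'_def by (metis bij_betw_def inv_into_f_f)
  define h where "h x = (\<lambda>i. if i \<in> {1..n} then e' (pair_action x (e i)) else i)" for x
  have h_in: "h x i \<in> {1..n}" if "x \<in> A" "i \<in> {1..n}" for x i
    using that by (simp only: h_def if_True) (intro e'_in pair_action_in e_in)
  have e_h: "e (h x i) = pair_action x (e i)" if "x \<in> A" "i \<in> {1..n}" for x i
    using that by (simp only: h_def if_True) (intro e_e' pair_action_in e_in)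
  have h_circ: "h (x \<circ>\<^sub>A y) = h x \<circ> h y" if "x \<in> A" "y \<in> A" for x y
  proof
    fix i show "h (x \<circ>\<^sub>A y) i = (h x \<circ> h y) i"
    proof (cases "i \<in> {1..n}")
      case True
      then have "e' (pair_action (x \<circ>\<^sub>A y) (e i)) = e' (pair_action x (e (h y i)))"
        using that pair_action_circ e_in e_h by presburger
      then show ?thesis using True h_in[OF that(2) True] by (simp add: h_def del: atLeastAtMost_iff)
    qed (auto simp: h_def)
  qed
  have h_zero: "h 0 = id"
    using pair_action_zero e_in e'_e by (auto simp: h_def fun_eq_iff)
  have h_perm: "h x permutes {1..n}" if x: "x \<in> A" for x
  proof (rule bij_imp_permutes)
    obtain y where y: "y \<in> A" "x \<circ>\<^sub>A y = 0" "y \<circ>\<^sub>A x = 0"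
      using C.l_inv_ex[OF x] C.r_inv_ex[OF x] C.inv_equality x by (metis C.inv_closed C.l_inv C.r_inv)
    have "h x (h y i) = i" "h y (h x i) = i" for i
      using h_circ[OF x y(1)] h_circ[OF y(1) x] y h_zero by (metis comp_apply id_apply)+
    then show "bij_betw (h x) {1..n} {1..n}"
      using h_in x y(1) by (intro bij_betw_byWitness[where f' = "h y"]) (auto simp del: atLeastAtMost_iff)
  qed (auto simp: h_def)
  have h_inj: "inj_on h A"
  proof (rule inj_onI)
    fix x y assume xy: "x \<in> A" "y \<in> A" "h x = h y"
    have 0: "(0, 0) \<in> A \<times> A" using zero by simp
    \<comment> \<open>The second component of the image of \<open>(0, 0)\<close> recovers the acting element.\<close>
    have "pair_action x (e (e' (0, 0))) = pair_action y (e (e' (0, 0)))"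
      using xy e_h e'_in[OF 0] by metis
    then show "x = y" using xy by (simp add: e_e'[OF 0] pair_action_def)
  qed
  interpret add_grp: comm_group "\<lparr>carrier = A, monoid.mult = (+), one = 0\<rparr>" by (rule add_group)
  have "(fst \<circ> e) ` {1..n} \<subseteq> A" using e_in by fastforce
  then obtain psi where psi: "psi \<in> hom (Fa n) \<lparr>carrier = A, monoid.mult = (+), one = 0\<rparr>"
    and psi_of: "\<And>i. i \<in> {1..n} \<Longrightarrow> psi (frag_of i) = fst (e i)"
    using add_grp.free_Abelian_group_universal[of "fst \<circ> e" "{1..n}"] by auto
  have psi_in: "psi a \<in> A" if "a \<in> carrier (Fa n)" for a
    using psi that by (auto simp: hom_def)
  have psi_add: "psi (a + b) = psi a + psi b" if "a \<in> carrier (Fa n)" "b \<in> carrier (Fa n)" for a b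
    using psi that by (auto simp: hom_def simp del: One_nat_def)
  have Fa_diff: "a - b \<in> carrier (Fa n)" if "a \<in> carrier (Fa n)" "b \<in> carrier (Fa n)" for a b
    using that keys_diff[of a b] by auto
  have psi_diff: "psi (a - b) = psi a - psi b" if "a \<in> carrier (Fa n)" "b \<in> carrier (Fa n)" for a b
    using psi_add[OF Fa_diff[OF that] that(2)] by simp
  have Fa0: "0 \<in> carrier (Fa n)" by simp
  have psi_0: "psi 0 = 0" using psi_diff[OF Fa0 Fa0] by simp
  have psi_act: "psi (perm_action (h x) a) = lam x (psi a)"
    if x: "x \<in> A" and a: "a \<in> carrier (Fa n)" for x a
  proof -
    have "Poly_Mapping.keys a \<subseteq> {1..n}" using a by simp
    then have "a \<in> carrier (Fa n) \<and> psi (perm_action (h x) a) = lam x (psi a)"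
    proof (induction a rule: frag_induction)
      case zero
      show ?case using x by (simp add: perm_action_def psi_0 lam_of_zero)
    next
      case (one i)
      have "psi (frag_of (h x i)) = lam x (fst (e i))"
        using one x by (simp only: psi_of h_in e_h fst_pair_action)
      then show ?case using one by (simp add: perm_action_def psi_of)
    next
      case (diff a b)
      then have "perm_action (h x) a \<in> carrier (Fa n)" "perm_action (h x) b \<in> carrier (Fa n)"
        using perm_action_closed[OF h_perm[OF x]] by auto
      moreover have "perm_action (h x) (a - b) = perm_action (h x) a - perm_action (h x) b"
        by (simp add: perm_action_def frag_extend_diff)
      ultimately show ?case using diff x Fa_diff psi_in
        by (simp only: psi_diff lam_diff)
    qed
    then show ?thesis by simp
  qed
  define phi where "phi = h \<circ> psi"
  have psi_surj: "psi ` carrier (Fa n) = A"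
  proof
    show "A \<subseteq> psi ` carrier (Fa n)"
    proof
      fix x assume x: "x \<in> A"
      then have w: "(x, 0) \<in> A \<times> A" using zero by simp
      have "psi (frag_of (e' (x, 0))) = x" using psi_of e'_in[OF w] e_e'[OF w] by simp
      moreover have "frag_of (e' (x, 0)) \<in> carrier (Fa n)" using e'_in[OF w] by simp
      ultimately show "x \<in> psi ` carrier (Fa n)" by (metis imageI)
    qed
  qed (use psi_in in auto)
  have img: "phi ` carrier (Fa n) = h ` A" by (metis phi_def image_comp psi_surj)
  define H where "H = (sym_group n)\<lparr>carrier := h ` A\<rparr>"
  have hom: "h \<in> hom circ_grp H"
    by (auto simp: hom_def H_def sym_group_def circ_grp_def h_circ)
  have iso: "h \<in> iso circ_grp H"
    using hom h_inj by (simp add: iso_def bij_betw_def H_def circ_grp_def)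
  have grpH: "group H"
  proof -
    have "group (H\<lparr>carrier := h ` A, one := h 0\<rparr>)"
      using C.hom_imp_img_group[OF hom] by simp
    moreover have "H\<lparr>carrier := h ` A, one := h 0\<rparr> = H"
      by (simp add: H_def h_zero sym_group_def)
    ultimately show ?thesis by simp
  qed
  have sub: "subgroup {(a, phi a) |a. a \<in> carrier (Fa n)} (Fa_Sym n)" (is "subgroup ?S _")
  proof (rule group.subgroupI[OF group_Fa_Sym])
    show "?S \<subseteq> carrier (Fa_Sym n)"
      using psi_in h_perm by (auto simp: Fa_Sym_def semidirect_product_def sym_group_def phi_def
          simp del: carrier_free_Abelian_group_iff)
    show "?S \<noteq> {}" using Fa0 by blast
  next
    fix u assume "u \<in> ?S"
    then obtain a where a: "u = (a, phi a)" "a \<in> carrier (Fa n)" by auto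
    define x where "x = psi a"
    have x: "x \<in> A" using a psi_in by (simp add: x_def)
    obtain y where y: "y \<in> A" "y \<circ>\<^sub>A x = 0"
      using C.l_inv_ex[OF x] by auto
    \<comment> \<open>The inverse in the semidirect product; the brace law gives \<open>psi b = y\<close>.\<close>
    define b where "b = 0 - perm_action (h y) a"
    have act: "perm_action (h y) a \<in> carrier (Fa n)" by (rule perm_action_closed[OF h_perm[OF y(1)] a(2)])
    have b: "b \<in> carrier (Fa n)" unfolding b_def by (rule Fa_diff[OF Fa0 act])
    have sum0: "b + perm_action (h y) a = 0" by (simp add: b_def)
    have "psi b = - lam y x"
      unfolding b_def using psi_diff[OF Fa0 act] psi_act[OF y(1) a(2)] by (simp add: psi_0 x_def)
    then have psib: "psi b = y" using y(2) by (simp add: circ_eq add_eq_0_iff2)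
    have "(b, phi b) \<otimes>\<^bsub>Fa_Sym n\<^esub> (a, phi a) = \<one>\<^bsub>Fa_Sym n\<^esub>"
      using h_circ[OF y(1) x] y(2) h_zero sum0
      by (simp add: Fa_Sym_def semidirect_product_def sym_group_def phi_def psib flip: x_def)
    moreover have "(a, phi a) \<in> carrier (Fa_Sym n)" "(b, phi b) \<in> carrier (Fa_Sym n)"
      using a b psi_in h_perm by (auto simp: Fa_Sym_def semidirect_product_def sym_group_def phi_def
          simp del: carrier_free_Abelian_group_iff)
    ultimately have "inv\<^bsub>Fa_Sym n\<^esub> u = (b, phi b)"
      unfolding a(1) by (rule group.inv_equality[OF group_Fa_Sym])
    then show "inv\<^bsub>Fa_Sym n\<^esub> u \<in> ?S" using b by auto
  next
    fix u v assume "u \<in> ?S" "v \<in> ?S"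
    then obtain a b where u: "u = (a, phi a)" "a \<in> carrier (Fa n)"
      and v: "v = (b, phi b)" "b \<in> carrier (Fa n)" by auto
    define c where "c = a + perm_action (phi a) b"
    have act: "perm_action (phi a) b \<in> carrier (Fa n)"
      unfolding phi_def comp_def using u v by (intro perm_action_closed h_perm psi_in)
    have c: "c \<in> carrier (Fa n)"
      using u(2) act keys_add[of a "perm_action (phi a) b"] by (auto simp: c_def)
    have "psi c = psi a \<circ>\<^sub>A psi b"
      unfolding c_def psi_add[OF u(2) act] using psi_act[OF psi_in[OF u(2)] v(2)]
      by (simp add: phi_def circ_eq)
    then have "phi c = phi a \<circ> phi b"
      using h_circ psi_in u v by (simp add: phi_def)
    then have "u \<otimes>\<^bsub>Fa_Sym n\<^esub> v = (c, phi c)"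
      by (simp add: u v Fa_Sym_def semidirect_product_def sym_group_def c_def)
    then show "u \<otimes>\<^bsub>Fa_Sym n\<^esub> v \<in> ?S" using c by auto
  qed
  have "IYB_group H"
    unfolding IYB_group_def
  proof (intro conjI exI[of _ n] bexI[of _ phi])
    show "finite (carrier H)" using fin by (simp add: H_def)
    show "phi \<in> carrier (Fa n) \<rightarrow> carrier (sym_group n)"
      using psi_in h_perm by (auto simp: phi_def sym_group_def simp del: carrier_free_Abelian_group_iff)
    show "H \<cong> (sym_group n)\<lparr>carrier := phi ` carrier (Fa n)\<rparr>"
      unfolding img H_def by (rule iso_refl)
  qed (use grpH n sub in auto)
  with iso show thesis by (rule that[rotated])
qed

end

section \<open>Adjoint groups of nilpotent rings\<close>

text \<open>\<open>I k\<close> plays the role of the \<open>(k + 1)\<close>-st power of the ring \<open>I 0\<close>. The multiplication is a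
parameter because the ring to which this is applied multiplies functions by composition rather than
pointwise.\<close>

locale nilpotent_ring =
  fixes I :: "nat \<Rightarrow> 'r::ab_group_add set" and mul :: "'r \<Rightarrow> 'r \<Rightarrow> 'r" (infixl "\<cdot>" 70)
    and c :: nat
  assumes finite: "finite (I 0)"
    and zero: "\<And>k. 0 \<in> I k"
    and add: "\<And>k x y. x \<in> I k \<Longrightarrow> y \<in> I k \<Longrightarrow> x + y \<in> I k"
    and uminus: "\<And>k x. x \<in> I k \<Longrightarrow> - x \<in> I k"
    and desc: "\<And>k. I (Suc k) \<subseteq> I k"
    and nilpotent: "I c = {0}"
    and mul_in: "\<And>j k x y. x \<in> I j \<Longrightarrow> y \<in> I k \<Longrightarrow> x \<cdot> y \<in> I (Suc (j + k))"
    and assoc: "\<And>x y z. x \<in> I 0 \<Longrightarrow> y \<in> I 0 \<Longrightarrow> z \<in> I 0 \<Longrightarrow> x \<cdot> y \<cdot> z = x \<cdot> (y \<cdot> z)"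
    and distl: "\<And>x y z. x \<in> I 0 \<Longrightarrow> y \<in> I 0 \<Longrightarrow> z \<in> I 0 \<Longrightarrow> x \<cdot> (y + z) = x \<cdot> y + x \<cdot> z"
    and distr: "\<And>x y z. x \<in> I 0 \<Longrightarrow> y \<in> I 0 \<Longrightarrow> z \<in> I 0 \<Longrightarrow> (x + y) \<cdot> z = x \<cdot> z + y \<cdot> z"
begin

definition adj :: "'r \<Rightarrow> 'r \<Rightarrow> 'r" (infixl "\<odot>" 70) where
  "x \<odot> y = x + y + x \<cdot> y"

abbreviation adj_grp :: "'r monoid" where
  "adj_grp \<equiv> \<lparr>carrier = I 0, monoid.mult = (\<odot>), one = 0\<rparr>"

lemma diff: "x \<in> I k \<Longrightarrow> y \<in> I k \<Longrightarrow> x - y \<in> I k"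
  using add[of x k "- y"] uminus by simp

lemma antimono: "j \<le> k \<Longrightarrow> I k \<subseteq> I j"
  using lift_Suc_antimono_le[of I, OF desc] by blast

lemma mul_in_Suc: "x \<in> I k \<Longrightarrow> y \<in> I 0 \<Longrightarrow> x \<cdot> y \<in> I (Suc k)" "x \<in> I k \<Longrightarrow> y \<in> I 0 \<Longrightarrow> y \<cdot> x \<in> I (Suc k)"
  using mul_in[of x k y 0] mul_in[of y 0 x k] by simp_all

lemma mul_closed: "x \<in> I 0 \<Longrightarrow> y \<in> I 0 \<Longrightarrow> x \<cdot> y \<in> I 0"
  using mul_in_Suc(1)[of x 0 y] desc by blast

lemma mul_zero: "x \<in> I 0 \<Longrightarrow> x \<cdot> 0 = 0" "x \<in> I 0 \<Longrightarrow> 0 \<cdot> x = 0"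
  using distl[of x 0 0] distr[of 0 0 x] zero by simp_all

lemma distr_diff: "x \<in> I 0 \<Longrightarrow> y \<in> I 0 \<Longrightarrow> z \<in> I 0 \<Longrightarrow> (x - y) \<cdot> z = x \<cdot> z - y \<cdot> z"
  using distr[of "x - y" y z] diff[of x 0 y] by (simp add: algebra_simps)

lemma adj_closed: "x \<in> I 0 \<Longrightarrow> y \<in> I 0 \<Longrightarrow> x \<odot> y \<in> I 0"
  by (simp add: adj_def add mul_closed)

lemma adj_assoc:
  assumes "x \<in> I 0" "y \<in> I 0" "z \<in> I 0"
  shows "x \<odot> y \<odot> z = x \<odot> (y \<odot> z)"
  using assms by (simp add: adj_def distl distr add mul_closed assoc algebra_simps)

text \<open>The difference \<open>t = y - z\<close> satisfies \<open>t = - t \<cdot> x\<close>, so it lies in every power of the ring.\<close>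

lemma adj_right_cancel:
  assumes x: "x \<in> I 0" and yz: "y \<in> I 0" "z \<in> I 0" and eq: "y \<odot> x = z \<odot> x"
  shows "y = z"
proof -
  have t: "y - z = - ((y - z) \<cdot> x)"
    unfolding distr_diff[OF yz x] using eq by (simp add: adj_def algebra_simps)
  have "y - z \<in> I k" for k
  proof (induction k)
    case 0
    show ?case using diff yz by simp
  next
    case (Suc k)
    show ?case using uminus[OF mul_in_Suc(1)[OF Suc x]] t by simp
  qed
  then have "y - z \<in> I c" .
  then show ?thesis by (simp add: nilpotent)
qed

text \<open>Right translations are injective on a finite set, hence surjective. This replaces the geometric
series for the inverse of \<open>1 + x\<close>.\<close>

lemma adj_left_inverse:
  assumes x: "x \<in> I 0"
  shows "\<exists>y\<in>I 0. y \<odot> x = 0"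
proof -
  have "inj_on (\<lambda>y. y \<odot> x) (I 0)" by (rule inj_onI) (rule adj_right_cancel[OF x])
  moreover have "(\<lambda>y. y \<odot> x) ` I 0 \<subseteq> I 0" using adj_closed x by blast
  ultimately have "(\<lambda>y. y \<odot> x) ` I 0 = I 0" by (rule endo_inj_surj[OF finite, rotated])
  then show ?thesis using zero[of 0] by (metis imageE)
qed

lemma group_adj: "group adj_grp"
  by (rule groupI)
    (use adj_left_inverse in \<open>auto simp: adj_closed adj_assoc zero\<close>, auto simp: adj_def mul_zero)

lemma left_brace_adj: "left_brace (I 0) (\<odot>)"
  by (rule left_brace.intro) (auto simp: group_adj zero add uminus adj_def distl algebra_simps)

lemma subgroup_adj: "subgroup (I k) adj_grp"
proof (rule group.subgroupI[OF group_adj])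
  have sub: "I k \<subseteq> I 0" by (rule antimono) simp
  then show "I k \<subseteq> carrier adj_grp" by simp
  show "I k \<noteq> {}" using zero by blast
next
  fix x y assume x: "x \<in> I k" and y: "y \<in> I k"
  have "y \<in> I 0" using y antimono[of 0 k] by auto
  then have "x \<cdot> y \<in> I k" using mul_in_Suc(1)[OF x] desc by blast
  then have "x \<odot> y \<in> I k" using x y by (simp add: adj_def add)
  then show "x \<otimes>\<^bsub>adj_grp\<^esub> y \<in> I k" by simp
next
  interpret G: group adj_grp by (rule group_adj)
  fix x assume x: "x \<in> I k"
  define y where "y = inv\<^bsub>adj_grp\<^esub> x"
  have x0: "x \<in> carrier adj_grp" using x antimono[of 0 k] by auto
  have y0: "y \<in> I 0" using G.inv_closed[OF x0] by (simp add: y_def)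
  have "x \<odot> y = 0" using G.r_inv[OF x0] by (simp add: y_def)
  then have "x \<cdot> y + (x + y) = 0" by (simp add: adj_def add.commute)
  then have "y = - x - x \<cdot> y" by (simp add: add_eq_0_iff algebra_simps)
  moreover have "x \<cdot> y \<in> I k" using mul_in_Suc(1)[OF x y0] desc by blast
  ultimately show "inv\<^bsub>adj_grp\<^esub> x \<in> I k"
    using diff[OF uminus[OF x], of "x \<cdot> y"] by (simp flip: y_def)
qed

text \<open>The commutator \<open>w\<close> satisfies \<open>w \<odot> (y \<odot> x) = x \<odot> y\<close>, i.e.
  \<open>w = (x \<cdot> y - y \<cdot> x) - w \<cdot> (y \<odot> x)\<close>, whence \<open>w\<close> climbs the filtration up to the
  level of the ring commutator.\<close>

lemma adj_commutator:
  assumes x: "x \<in> I k" and y: "y \<in> I 0"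
    and w: "w \<in> I 0" and eq: "w \<odot> (y \<odot> x) = x \<odot> y"
  shows "w \<in> I (Suc k)"
proof -
  have x0: "x \<in> I 0" using x antimono[of 0 k] by auto
  define d where "d = x \<cdot> y - y \<cdot> x"
  have d: "d \<in> I (Suc k)" unfolding d_def by (intro diff mul_in_Suc x y)
  have "w + y \<odot> x + w \<cdot> (y \<odot> x) = x \<odot> y" using eq by (simp add: adj_def[of w])
  then have w_eq: "w = d - w \<cdot> (y \<odot> x)"
    by (simp add: d_def adj_def[of x y] adj_def[of y x] algebra_simps)
  have "j \<le> Suc k \<Longrightarrow> w \<in> I j" for j
  proof (induction j)
    case 0
    show ?case using w by simp
  next
    case (Suc j)
    then have "w \<cdot> (y \<odot> x) \<in> I (Suc j)" using mul_in_Suc(1) adj_closed y x0 by simp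
    moreover have "d \<in> I (Suc j)" using d antimono[OF Suc.prems] by auto
    ultimately show ?case using w_eq diff by metis
  qed
  then show ?thesis by simp
qed

lemma nilpotent_adj: "nilpotent_group adj_grp"
proof (rule nilpotent_group_if_central_chain[where \<Gamma> = I])
  show "group adj_grp" by (rule group_adj)
  interpret G: group adj_grp by (rule group_adj)
  fix k x y assume x: "x \<in> I k" and y: "y \<in> carrier adj_grp"
  let ?w = "x \<otimes>\<^bsub>adj_grp\<^esub> y \<otimes>\<^bsub>adj_grp\<^esub> inv\<^bsub>adj_grp\<^esub> x \<otimes>\<^bsub>adj_grp\<^esub> inv\<^bsub>adj_grp\<^esub> y"
  have xy: "x \<in> carrier adj_grp" "y \<in> carrier adj_grp" using x antimono[of 0 k] y by auto
  have "?w \<otimes>\<^bsub>adj_grp\<^esub> (y \<otimes>\<^bsub>adj_grp\<^esub> x) = x \<otimes>\<^bsub>adj_grp\<^esub> y"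
    by (rule G.commutator_mult[OF xy])
  moreover have "?w \<in> carrier adj_grp" using xy by (intro G.m_closed G.inv_closed)
  ultimately show "?w \<in> I (Suc k)" using y by (intro adj_commutator[OF x, of y]) simp_all
qed (use subgroup_adj nilpotent in simp_all)

lemma nilpotent_IYB_copy:
  obtains H :: "(nat \<Rightarrow> nat) monoid" and h
  where "IYB_group H" "nilpotent_group H" "h \<in> iso adj_grp H"
proof -
  interpret left_brace "I 0" "(\<odot>)" by (rule left_brace_adj)
  obtain H :: "(nat \<Rightarrow> nat) monoid" and h where H: "IYB_group H" and h: "h \<in> iso adj_grp H"
    using IYB_copy[OF finite] unfolding circ_grp_def by blast
  have "nilpotent_group H"
    using nilpotent_group_iso[OF h nilpotent_adj] H by (simp add: IYB_group_def)
  with H h show thesis using that by blast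
qed

end

section \<open>Degree-lowering endomorphisms of a filtered abelian group\<close>

locale filtered_group =
  fixes F :: "nat \<Rightarrow> 'm::ab_group_add set" and c :: nat
  assumes zero: "\<And>k. 0 \<in> F k"
    and add: "\<And>k x y. x \<in> F k \<Longrightarrow> y \<in> F k \<Longrightarrow> x + y \<in> F k"
    and uminus: "\<And>k x. x \<in> F k \<Longrightarrow> - x \<in> F k"
    and asc: "\<And>k. F k \<subseteq> F (Suc k)"
    and top: "\<And>k. F k \<subseteq> F c"
    and bot: "F 0 = {0}"
    and finite: "finite (F c)"
begin

text \<open>Endomorphisms of \<open>F c\<close> that lower the filtration by at least \<open>k + 1\<close> steps; truncated subtraction
is right here because \<open>F 0\<close> is trivial. The value \<open>0\<close> outside \<open>F c\<close> makes an endomorphism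
determined by its restriction to \<open>F c\<close>, so that there are only finitely many.\<close>

definition lowering :: "nat \<Rightarrow> ('m \<Rightarrow> 'm) set" where
  "lowering k = {r. (\<forall>x. x \<notin> F c \<longrightarrow> r x = 0) \<and> (\<forall>x\<in>F c. \<forall>y\<in>F c. r (x + y) = r x + r y) \<and>
     (\<forall>i. \<forall>x\<in>F i. r x \<in> F (i - Suc k))}"

lemma mono: "i \<le> j \<Longrightarrow> F i \<subseteq> F j"
  using lift_Suc_mono_le[of F, OF asc] by blast

lemma lowering_in_top: "r \<in> lowering k \<Longrightarrow> r x \<in> F c"
  using top[of "c - Suc k"] zero by (cases "x \<in> F c") (auto simp: lowering_def)

lemma lowering_zero: "r \<in> lowering k \<Longrightarrow> r 0 = 0"
proof -
  assume "r \<in> lowering k"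
  then have "r (0 + 0) = r 0 + r 0" using zero unfolding lowering_def by blast
  then show ?thesis by simp
qed

lemma nilpotent_ring_lowering: "nilpotent_ring lowering (\<circ>) c"
proof (rule nilpotent_ring.intro)
  show "finite (lowering 0)"
  proof (rule finite_subset)
    show "finite {r. \<forall>x. (x \<in> F c \<longrightarrow> r x \<in> F c) \<and> (x \<notin> F c \<longrightarrow> r x = 0)}"
      by (intro finite_set_of_finite_funs finite)
    show "lowering 0 \<subseteq> {r. \<forall>x. (x \<in> F c \<longrightarrow> r x \<in> F c) \<and> (x \<notin> F c \<longrightarrow> r x = 0)}"
      using lowering_in_top by (auto simp: lowering_def)
  qed
  show "0 \<in> lowering k" for k using zero by (auto simp: lowering_def)
  show "r + s \<in> lowering k" if "r \<in> lowering k" "s \<in> lowering k" for k r s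
    using that add by (auto simp: lowering_def algebra_simps)
  show "- r \<in> lowering k" if "r \<in> lowering k" for k r
    using that uminus by (auto simp: lowering_def)
  show "lowering (Suc k) \<subseteq> lowering k" for k
  proof -
    have "F (i - Suc (Suc k)) \<subseteq> F (i - Suc k)" for i by (rule mono) simp
    then show ?thesis unfolding lowering_def by blast
  qed
  show "lowering c = {0}"
  proof
    show "lowering c \<subseteq> {0}"
    proof
      fix r assume r: "r \<in> lowering c"
      have "r x = 0" for x
      proof (cases "x \<in> F c")
        case True
        then have "r x \<in> F (c - Suc c)" using r unfolding lowering_def by blast
        then show ?thesis using bot by simp
      qed (use r in \<open>auto simp: lowering_def\<close>)
      then show "r \<in> {0}" by (auto simp: fun_eq_iff)
    qed
  qed (use zero in \<open>auto simp: lowering_def\<close>)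
  show "r \<circ> s \<in> lowering (Suc (j + k))" if r: "r \<in> lowering j" and s: "s \<in> lowering k" for j k r s
  proof -
    have "(r \<circ> s) x \<in> F (i - Suc (Suc (j + k)))" if "x \<in> F i" for x i
    proof -
      have "s x \<in> F (i - Suc k)" using s that unfolding lowering_def by blast
      then have "r (s x) \<in> F (i - Suc k - Suc j)" using r unfolding lowering_def by blast
      then show ?thesis by (simp add: algebra_simps)
    qed
    moreover have "(r \<circ> s) x = 0" if "x \<notin> F c" for x
      using s that lowering_zero[OF r] by (simp add: lowering_def)
    moreover have "(r \<circ> s) (x + y) = (r \<circ> s) x + (r \<circ> s) y" if "x \<in> F c" "y \<in> F c" for x y
    proof -
      have "s (x + y) = s x + s y" using s that by (simp add: lowering_def)
      then show ?thesis using r lowering_in_top[OF s] by (simp add: lowering_def)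
    qed
    ultimately show ?thesis unfolding lowering_def by blast
  qed
  show "r \<circ> s \<circ> t = r \<circ> (s \<circ> t)" for r s t :: "'m \<Rightarrow> 'm" by (rule comp_assoc)
  show "r \<circ> (s + t) = (r \<circ> s) + (r \<circ> t)" if "r \<in> lowering 0" "s \<in> lowering 0" "t \<in> lowering 0" for r s t
    using that(1) lowering_in_top[OF that(2)] lowering_in_top[OF that(3)]
    by (auto simp: lowering_def fun_eq_iff)
  show "(r + s) \<circ> t = (r \<circ> t) + (s \<circ> t)" for r s t :: "'m \<Rightarrow> 'm" by (simp add: fun_eq_iff)
qed

end

section \<open>The Frobenius identity for additive operators\<close>

text \<open>The multiple \<open>n x\<close> in an additive monoid that need not be a semiring.\<close>

primrec nat_scale :: "nat \<Rightarrow> 'm::comm_monoid_add \<Rightarrow> 'm" where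
  "nat_scale 0 x = 0"
| "nat_scale (Suc n) x = x + nat_scale n x"

lemma nat_scale_zero [simp]: "nat_scale n 0 = 0"
  by (induction n) auto

lemma nat_scale_add: "nat_scale n (x + y) = nat_scale n x + nat_scale n y"
  by (induction n) (auto simp: algebra_simps)

lemma nat_scale_add_left: "nat_scale (m + n) x = nat_scale m x + nat_scale n x"
  by (induction m) (auto simp: algebra_simps)

lemma nat_scale_mult: "nat_scale (m * n) x = nat_scale m (nat_scale n x)"
  by (induction m) (auto simp: nat_scale_add_left)

lemma nat_scale_uminus: "nat_scale n (- x) = - nat_scale n (x :: 'm::ab_group_add)"
  by (induction n) auto

lemma nat_scale_eq_0_dvd:
  assumes "nat_scale m x = 0" and "m dvd n"
  shows "nat_scale n x = 0"
  using assms by (metis dvd_def mult.commute nat_scale_mult nat_scale_zero)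

lemma nat_scale_fun: "nat_scale n f = (\<lambda>x. nat_scale n (f x))"
  by (induction n) (auto simp: fun_eq_iff)

lemma additive_nat_scale:
  fixes T :: "'m::ab_group_add \<Rightarrow> 'm"
  assumes "\<And>x y. T (x + y) = T x + T y"
  shows "T (nat_scale n x) = nat_scale n (T x)"
proof (induction n)
  case 0
  show ?case using assms[of 0 0] by simp
qed (simp add: assms)

text \<open>The binomial theorem for \<open>T = D + 1\<close> with \<open>D = T - 1\<close>, in the commutative ring generated by \<open>T\<close>.\<close>

lemma newton_forward:
  fixes T :: "'m::ab_group_add \<Rightarrow> 'm"
  assumes add: "\<And>x y. T (x + y) = T x + T y"
  shows "(T ^^ n) x = (\<Sum>j\<le>n. nat_scale (n choose j) (((\<lambda>x. T x - x) ^^ j) x))"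
proof (induction n)
  case (Suc n)
  define D where "D = (\<lambda>x. T x - x)"
  have T: "T y = D y + y" for y by (simp add: D_def)
  have T0: "T 0 = 0" using add[of 0 0] by simp
  have Tsum: "T (sum h A) = (\<Sum>a\<in>A. T (h a))" for h and A :: "nat set"
    by (induction A rule: infinite_finite_induct) (auto simp: T0 add)
  have "(T ^^ Suc n) x = (\<Sum>j\<le>n. nat_scale (n choose j) (T ((D ^^ j) x)))"
    using Suc by (simp add: Tsum additive_nat_scale[of T, OF add] D_def)
  also have "\<dots> = (\<Sum>j\<le>n. nat_scale (n choose j) ((D ^^ Suc j) x)) + (\<Sum>j\<le>n. nat_scale (n choose j) ((D ^^ j) x))"
    by (simp add: T nat_scale_add sum.distrib)
  also have "(\<Sum>j\<le>n. nat_scale (n choose j) ((D ^^ j) x)) = (\<Sum>j\<le>Suc n. nat_scale (n choose j) ((D ^^ j) x))"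
    by (simp add: binomial_eq_0)
  also have "\<dots> = x + (\<Sum>j\<le>n. nat_scale (n choose Suc j) ((D ^^ Suc j) x))"
    by (subst sum.atMost_Suc_shift) simp
  also have "(\<Sum>j\<le>n. nat_scale (n choose j) ((D ^^ Suc j) x)) + \<dots> =
     x + (\<Sum>j\<le>n. nat_scale (Suc n choose Suc j) ((D ^^ Suc j) x))"
    by (simp add: nat_scale_add_left sum.distrib)
  also have "\<dots> = (\<Sum>j\<le>Suc n. nat_scale (Suc n choose j) ((D ^^ j) x))"
    by (subst sum.atMost_Suc_shift) simp
  finally show ?case by (simp add: D_def)
qed simp

text \<open>The binomial coefficients strictly between \<open>0\<close> and \<open>p\<close> vanish on elements killed by \<open>p\<close>.\<close>

lemma freshman_power_prime:
  fixes T :: "'m::ab_group_add \<Rightarrow> 'm"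
  assumes add: "\<And>x y. T (x + y) = T x + T y"
    and p: "prime p" and x: "nat_scale p x = 0"
  shows "((\<lambda>x. T x - x) ^^ p) x = (T ^^ p) x - x"
proof -
  define D where "D = (\<lambda>x. T x - x)"
  have Dadd: "D (x + y) = D x + D y" for x y by (simp add: D_def add)
  have tor: "nat_scale p ((D ^^ j) x) = 0" for j
  proof (induction j)
    case (Suc j)
    then show ?case using additive_nat_scale[of D p "(D ^^ j) x", OF Dadd] Dadd[of 0 0] by simp
  qed (simp add: x)
  have p1: "p > 1" using p by (rule prime_gt_1_nat)
  have mid: "nat_scale (p choose j) ((D ^^ j) x) = 0" if "j \<in> {..p} - {0, p}" for j
    using that p by (intro nat_scale_eq_0_dvd[OF tor] dvd_choose_prime) auto
  have "(T ^^ p) x = (\<Sum>j\<le>p. nat_scale (p choose j) ((D ^^ j) x))"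
    using newton_forward[OF add] by (simp add: D_def)
  also have "\<dots> = (\<Sum>j\<in>{0, p}. nat_scale (p choose j) ((D ^^ j) x))"
    using mid by (intro sum.mono_neutral_right) auto
  also have "\<dots> = x + (D ^^ p) x"
    using p1 by simp
  finally show ?thesis by (simp add: D_def)
qed

text \<open>Iterating the prime case: \<open>(T - 1) ^ (p ^ k)\<close> agrees with \<open>T ^ (p ^ k) - 1\<close> on elements killed by \<open>p\<close>,
and the prime case applies to the operator \<open>U = T ^ (p ^ k)\<close>.\<close>

lemma freshman_power_prime_power:
  fixes T :: "'m::ab_group_add \<Rightarrow> 'm"
  assumes add: "\<And>x y. T (x + y) = T x + T y"
    and p: "prime p" and x: "nat_scale p x = 0"
  shows "((\<lambda>x. T x - x) ^^ (p ^ k)) x = (T ^^ (p ^ k)) x - x"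
  using x
proof (induction k arbitrary: x)
  case (Suc k)
  define U where "U = T ^^ (p ^ k)"
  have Uadd: "U (x + y) = U x + U y" for x y
  proof -
    have "(T ^^ m) (x + y) = (T ^^ m) x + (T ^^ m) y" for m
      by (induction m) (auto simp: add)
    then show ?thesis by (simp add: U_def)
  qed
  have U0: "U 0 = 0" using Uadd[of 0 0] by simp
  define D where "D = (\<lambda>x. T x - x)"
  have IH: "(D ^^ (p ^ k)) y = U y - y" if "nat_scale p y = 0" for y
    using Suc.IH[OF that] by (simp add: U_def D_def)
  have tor: "nat_scale p (((\<lambda>x. U x - x) ^^ m) x) = 0" for m
  proof (induction m)
    case (Suc m)
    then show ?case
      using additive_nat_scale[of "\<lambda>x. U x - x" p "((\<lambda>x. U x - x) ^^ m) x"] by (simp add: Uadd U0)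
  qed (simp add: Suc.prems)
  have eq: "((D ^^ (p ^ k)) ^^ m) x = ((\<lambda>x. U x - x) ^^ m) x" for m
    by (induction m) (auto simp: IH tor)
  have "(D ^^ (p ^ Suc k)) x = ((D ^^ (p ^ k)) ^^ p) x"
    by (simp add: funpow_mult mult.commute)
  also have "\<dots> = (U ^^ p) x - x"
    using freshman_power_prime[where T=U, OF Uadd p Suc.prems] by (simp add: eq)
  also have "(U ^^ p) x = (T ^^ (p ^ Suc k)) x"
    by (simp add: U_def funpow_mult mult.commute)
  finally show ?case by (simp add: D_def)
qed simp

section \<open>The group of rationals modulo the integers\<close>

text \<open>A single divisible torsion group contains cyclic groups of every order, so that functions with
values in it handle all primes together.\<close>

quotient_type rat_circle = rat / "\<lambda>x y. x - y \<in> \<int>"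
proof (rule equivpI)
  show "reflp (\<lambda>x y::rat. x - y \<in> \<int>)" by (rule reflpI) simp
  show "symp (\<lambda>x y::rat. x - y \<in> \<int>)"
    by (rule sympI) (metis Ints_minus minus_diff_eq)
  show "transp (\<lambda>x y::rat. x - y \<in> \<int>)"
    by (rule transpI) (metis Ints_add diff_add_cancel add_diff_eq)
qed

instantiation rat_circle :: ab_group_add
begin

lift_definition zero_rat_circle :: rat_circle is 0 .

lift_definition plus_rat_circle :: "rat_circle \<Rightarrow> rat_circle \<Rightarrow> rat_circle" is "(+)"
  proof -
  fix a b c d :: rat
  assume "a - b \<in> \<int>" "c - d \<in> \<int>"
  then have "(a - b) + (c - d) \<in> \<int>" by (rule Ints_add)
  then show "(a + c) - (b + d) \<in> \<int>" by (simp add: algebra_simps)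
qed

lift_definition uminus_rat_circle :: "rat_circle \<Rightarrow> rat_circle" is uminus
  proof -
  fix a b :: rat
  assume "a - b \<in> \<int>"
  then have "- (a - b) \<in> \<int>" by (rule Ints_minus)
  then show "- a - - b \<in> \<int>" by simp
qed

definition minus_rat_circle :: "rat_circle \<Rightarrow> rat_circle \<Rightarrow> rat_circle" where
  "minus_rat_circle x y = x + - y"

instance
proof
  fix a b c :: rat_circle
  show "a + b + c = a + (b + c)" by transfer (simp add: algebra_simps)
  show "a + b = b + a" by transfer (simp add: algebra_simps)
  show "0 + a = a" by transfer simp
  show "- a + a = 0" by transfer simp
  show "a - b = a + - b" by (rule minus_rat_circle_def)
qed

end

lemma nat_scale_abs_rat_circle: "nat_scale n (abs_rat_circle r) = abs_rat_circle (of_nat n * r)"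
proof (induction n)
  case 0
  show ?case by (simp add: zero_rat_circle_def)
next
  case (Suc n)
  then show ?case by (simp add: plus_rat_circle.abs_eq algebra_simps)
qed

lemma abs_rat_circle_eq_0_iff: "abs_rat_circle r = 0 \<longleftrightarrow> r \<in> \<int>"
  by (simp add: zero_rat_circle_def rat_circle.abs_eq_iff)

lemma finite_rat_circle_torsion:
  assumes "n > 0"
  shows "finite {x :: rat_circle. nat_scale n x = 0}"
proof (rule finite_subset)
  show "{x :: rat_circle. nat_scale n x = 0} \<subseteq> (\<lambda>i. abs_rat_circle (of_int i / of_nat n)) ` {0..<int n}"
  proof
    fix x :: rat_circle assume "x \<in> {x. nat_scale n x = 0}"
    moreover obtain r where r: "x = abs_rat_circle r" by (metis Quotient_abs_rep Quotient_rat_circle)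
    ultimately have "of_nat n * r \<in> \<int>" by (simp add: nat_scale_abs_rat_circle abs_rat_circle_eq_0_iff)
    then obtain i where i: "of_nat n * r = of_int i" by (auto elim: Ints_cases)
    define d where "d = i div int n"
    define m where "m = i mod int n"
    have "i = d * int n + m" by (simp add: d_def m_def)
    then have "r = of_int d + of_int m / of_nat n"
      using i assms by (simp add: field_simps)
    then have "x = abs_rat_circle (of_int m / of_nat n)"
      by (simp add: r rat_circle.abs_eq_iff)
    then show "x \<in> (\<lambda>i. abs_rat_circle (of_int i / of_nat n)) ` {0..<int n}"
      using assms by (auto simp: m_def)
  qed
qed auto

lemma ex_rat_circle_order_prime:
  assumes "p > 1"
  obtains x :: rat_circle where "x \<noteq> 0" "nat_scale p x = 0"
proof
  show "nat_scale p (abs_rat_circle (1 / of_nat p)) = 0"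
    using assms by (simp add: nat_scale_abs_rat_circle abs_rat_circle_eq_0_iff)
  have "(1 / of_nat p :: rat) \<notin> \<int>"
  proof
    assume "(1 / of_nat p :: rat) \<in> \<int>"
    then obtain i where "(1 / of_nat p :: rat) = of_int i" by (auto elim: Ints_cases)
    then have "(1::rat) = of_int (i * int p)" using assms by (simp add: field_simps)
    then have "1 = i * int p" by (metis of_int_1 of_int_eq_iff)
    then have "int p dvd 1" by (metis dvd_triv_right)
    then show False using assms by simp
  qed
  then show "abs_rat_circle (1 / of_nat p) \<noteq> 0" by (simp add: abs_rat_circle_eq_0_iff)
qed

section \<open>Polynomial functions on a group\<close>

context group
begin

text \<open>Right translation makes \<open>shift\<close> a left action. All functions considered vanish outside the carrier.\<close>

definition shift :: "'a \<Rightarrow> ('a \<Rightarrow> rat_circle) \<Rightarrow> ('a \<Rightarrow> rat_circle)" where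
  "shift g f = (\<lambda>x. if x \<in> carrier G then f (x \<otimes> g) else 0)"

definition torsion_functions :: "('a \<Rightarrow> rat_circle) set" where
  "torsion_functions = {f. (\<forall>x. x \<notin> carrier G \<longrightarrow> f x = 0) \<and> nat_scale (order G) f = 0}"

text \<open>The polynomial functions of degree less than \<open>k\<close>, in other words the torsion functions annihilated by the
\<open>k\<close>-th power of the augmentation ideal of the integral group ring.\<close>

primrec polynomials :: "nat \<Rightarrow> ('a \<Rightarrow> rat_circle) set" where
  "polynomials 0 = {0}"
| "polynomials (Suc k) = {f \<in> torsion_functions. \<forall>g\<in>carrier G. shift g f - f \<in> polynomials k}"

lemma polynomials_Suc_iff:
  "f \<in> polynomials (Suc k) \<longleftrightarrow>
     f \<in> torsion_functions \<and> (\<forall>g\<in>carrier G. shift g f - f \<in> polynomials k)"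
  by simp

declare polynomials.simps(2) [simp del]

lemma shift_add: "shift g (f + h) = shift g f + shift g h"
  by (auto simp: shift_def)

lemma shift_uminus: "shift g (- f) = - shift g f"
  by (auto simp: shift_def)

lemma shift_diff: "shift g (f - h) = shift g f - shift g h"
  by (auto simp: shift_def)

lemma shift_zero [simp]: "shift g 0 = 0"
  by (auto simp: shift_def)

lemma shift_mult: "g \<in> carrier G \<Longrightarrow> h \<in> carrier G \<Longrightarrow> shift (g \<otimes> h) f = shift g (shift h f)"
  by (auto simp: shift_def m_assoc)

lemma shift_one: "f \<in> torsion_functions \<Longrightarrow> shift \<one> f = f"
  by (auto simp: shift_def torsion_functions_def)

lemma nat_scale_shift: "nat_scale n (shift g f) = shift g (nat_scale n f)"
  by (rule additive_nat_scale[symmetric]) (rule shift_add)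

lemma torsion_functions_shift: "f \<in> torsion_functions \<Longrightarrow> shift g f \<in> torsion_functions"
  by (simp add: torsion_functions_def nat_scale_shift) (simp add: shift_def)

lemma torsion_functions_add: "f \<in> torsion_functions \<Longrightarrow> h \<in> torsion_functions \<Longrightarrow> f + h \<in> torsion_functions"
  by (simp add: torsion_functions_def nat_scale_add)

lemma torsion_functions_uminus: "f \<in> torsion_functions \<Longrightarrow> - f \<in> torsion_functions"
  by (simp add: torsion_functions_def nat_scale_uminus)

lemma torsion_functions_diff: "f \<in> torsion_functions \<Longrightarrow> h \<in> torsion_functions \<Longrightarrow> f - h \<in> torsion_functions"
  using torsion_functions_add[of f "- h"] torsion_functions_uminus by simp

lemma torsion_functions_zero: "0 \<in> torsion_functions"
  by (simp add: torsion_functions_def)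

lemma finite_torsion_functions:
  assumes "finite (carrier G)"
  shows "finite torsion_functions"
proof (rule finite_subset)
  have "order G > 0" using assms by (simp add: order_gt_0_iff_finite)
  then show "finite {f. \<forall>x. (x \<in> carrier G \<longrightarrow> f x \<in> {y :: rat_circle. nat_scale (order G) y = 0}) \<and>
      (x \<notin> carrier G \<longrightarrow> f x = 0)}"
    by (intro finite_set_of_finite_funs assms finite_rat_circle_torsion)
qed (auto simp: torsion_functions_def nat_scale_fun fun_eq_iff)

lemma polynomials_subset: "polynomials k \<subseteq> torsion_functions"
  by (cases k) (auto simp: torsion_functions_zero polynomials_Suc_iff)

lemma polynomials_zero: "0 \<in> polynomials k"
proof (induction k)
  case (Suc k)
  have "shift g 0 - 0 \<in> polynomials k" for g
    unfolding shift_zero diff_zero by (rule Suc)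
  then show ?case unfolding polynomials_Suc_iff by (blast intro: torsion_functions_zero)
qed (simp only: polynomials.simps singleton_iff)

lemma polynomials_add: "f \<in> polynomials k \<Longrightarrow> h \<in> polynomials k \<Longrightarrow> f + h \<in> polynomials k"
proof (induction k arbitrary: f h)
  case (Suc k)
  have eq: "shift g (f + h) - (f + h) = (shift g f - f) + (shift g h - h)" for g
    by (simp add: shift_add)
  show ?case using Suc unfolding polynomials_Suc_iff eq by (blast intro: torsion_functions_add)
qed simp

lemma polynomials_uminus: "f \<in> polynomials k \<Longrightarrow> - f \<in> polynomials k"
proof (induction k arbitrary: f)
  case (Suc k)
  have eq: "shift g (- f) - (- f) = - (shift g f - f)" for g
    by (simp add: shift_uminus)
  show ?case using Suc unfolding polynomials_Suc_iff eq by (blast intro: torsion_functions_uminus)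
qed simp

lemma polynomials_asc: "polynomials k \<subseteq> polynomials (Suc k)"
proof (induction k)
  case 0
  show ?case using polynomials_zero[of 1] by auto
next
  case (Suc k)
  then show ?case unfolding subset_iff polynomials_Suc_iff by blast
qed

lemma polynomials_mono: "j \<le> k \<Longrightarrow> polynomials j \<subseteq> polynomials k"
  using lift_Suc_mono_le[of polynomials, OF polynomials_asc] by blast

text \<open>There are only finitely many functions, so the degrees that occur are bounded.\<close>

lemma polynomials_stabilise:
  assumes "finite (carrier G)"
  obtains c where "\<And>k. polynomials k \<subseteq> polynomials c"
proof -
  define P where "P = (\<Union>k. polynomials k)"
  have "finite P"
    using finite_subset[OF _ finite_torsion_functions[OF assms]] polynomials_subset unfolding P_def by blast
  moreover have "\<forall>f\<in>P. \<exists>k. f \<in> polynomials k" by (auto simp: P_def)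
  then obtain d where d: "\<And>f. f \<in> P \<Longrightarrow> f \<in> polynomials (d f)" by metis
  ultimately have "d f \<le> Max (d ` P)" if "f \<in> P" for f using that by simp
  then have "P \<subseteq> polynomials (Max (d ` P))" using d polynomials_mono by blast
  then show thesis by (intro that) (auto simp only: P_def)
qed

text \<open>The finitely many differences \<open>shift g f - f\<close> have a common degree bound \<open>c\<close>, so \<open>f\<close> has degree at
most \<open>c\<close>.\<close>

lemma polynomials_closed:
  assumes "finite (carrier G)" and f: "f \<in> torsion_functions"
    and diff: "\<And>g. g \<in> carrier G \<Longrightarrow> shift g f - f \<in> (\<Union>k. polynomials k)"
  shows "f \<in> (\<Union>k. polynomials k)"
proof -
  obtain c where "\<And>k. polynomials k \<subseteq> polynomials c" by (rule polynomials_stabilise[OF assms(1)]) blast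
  then have "f \<in> polynomials (Suc c)" using f diff unfolding polynomials_Suc_iff by blast
  then show ?thesis by blast
qed

definition invariants :: "nat \<Rightarrow> 'a set \<Rightarrow> ('a \<Rightarrow> rat_circle) set" where
  "invariants p S = {f \<in> torsion_functions. nat_scale p f = 0 \<and> (\<forall>s\<in>S. shift s f = f)}"

lemma invariants_diff: "f \<in> invariants p S \<Longrightarrow> h \<in> invariants p S \<Longrightarrow> f - h \<in> invariants p S"
  using nat_scale_add[of p f "- h"]
  by (auto simp: invariants_def torsion_functions_diff shift_diff nat_scale_uminus)

lemma invariants_mono: "S \<subseteq> T \<Longrightarrow> invariants p T \<subseteq> invariants p S"
  by (auto simp: invariants_def)

lemma shift_funpow:
  assumes "g \<in> carrier G" "f \<in> torsion_functions"
  shows "(shift g ^^ m) f = shift (g [^] m) f"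
proof (induction m)
  case (Suc m)
  have "shift (g [^] Suc m) f = shift (g \<otimes> g [^] m) f"
    using assms by (metis nat_pow_Suc2)
  then show ?case using Suc assms by (simp add: shift_mult)
qed (simp add: assms shift_one)

text \<open>The main step. Here \<open>Z \<subseteq> Y\<close> are consecutive terms of a central series with factor of exponent
dividing \<open>p ^ k\<close>. Starting with the \<open>Y\<close>-invariant functions, the elements \<open>z\<close> of \<open>Y\<close> are released
one after another until only invariance under \<open>Z\<close> remains. To release \<open>z\<close> (\<open>drop\<close>), use that
the difference operator \<open>D\<close> of \<open>z\<close> is nilpotent on the functions in question (\<open>nil\<close>), so
that it suffices to pass from \<open>D f\<close> to \<open>f\<close> (\<open>lift\<close>). This goes by induction on the degree of \<open>D f\<close>:
since \<open>D\<close> commutes with translations, the differences of \<open>f\<close> satisfy the same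
hypothesis with smaller degree, and if \<open>D f = 0\<close> then \<open>f\<close> is invariant under \<open>z\<close> as well.\<close>

lemma invariants_section_polynomial:
  assumes fin: "finite (carrier G)" and p: "prime p"
    and Z: "Z \<subseteq> Y" and Y: "Y \<subseteq> carrier G"
    and central: "\<And>y g. y \<in> Y \<Longrightarrow> g \<in> carrier G \<Longrightarrow> \<exists>z\<in>Z. y \<otimes> g = g \<otimes> y \<otimes> z"
    and expo: "\<And>y. y \<in> Y \<Longrightarrow> y [^] (p ^ k) \<in> Z"
    and Y_poly: "invariants p Y \<subseteq> (\<Union>k. polynomials k)"
  shows "invariants p Z \<subseteq> (\<Union>k. polynomials k)"
proof -
  define P where "P = (\<Union>k. polynomials k)"
  \<comment> \<open>Elements of \<open>Y\<close> are central modulo \<open>Z\<close>, so their translations commute with all others here.\<close>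
  have commute: "shift y (shift g f) = shift g (shift y f)"
    if f: "f \<in> invariants p Z" and y: "y \<in> Y" and g: "g \<in> carrier G" for f y g
  proof -
    obtain z where z: "z \<in> Z" "y \<otimes> g = g \<otimes> y \<otimes> z" using central[OF y g] by auto
    have "shift y (shift g f) = shift (g \<otimes> y \<otimes> z) f" using y g Y by (simp flip: z(2) add: shift_mult subset_iff)
    also have "\<dots> = shift g (shift y (shift z f))" using y g z(1) Y Z by (subst shift_mult, auto simp: shift_mult)
    also have "shift z f = f" using f z(1) by (simp add: invariants_def)
    finally show ?thesis .
  qed
  have drop: "invariants p S \<subseteq> P"
    if S: "Z \<subseteq> S" "S \<subseteq> Y" and z: "z \<in> Y" and ins: "invariants p (insert z S) \<subseteq> P" for S z
  proof -
    have sub: "invariants p S \<subseteq> invariants p Z" by (rule invariants_mono[OF S(1)])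
    have diff_in: "shift g f - f \<in> invariants p S" if f: "f \<in> invariants p S" and g: "g \<in> carrier G" for f g
    proof (rule invariants_diff[OF _ f])
      have "shift s (shift g f) = shift g f" if s: "s \<in> S" for s
        using commute[of f s g] f g s S sub by (auto simp: invariants_def)
      then show "shift g f \<in> invariants p S"
        using f by (auto simp: invariants_def torsion_functions_shift nat_scale_shift)
    qed
    have diff_tf: "f \<in> torsion_functions" if "f \<in> invariants p S" for f
      using that by (simp add: invariants_def)
    have lift: "f \<in> P" if "f \<in> invariants p S" "shift z f - f \<in> polynomials d" for f d
      using that
    proof (induction d arbitrary: f)
      case 0
      have "shift z f - f = 0" using 0 unfolding polynomials.simps by blast
      then have "shift z f = f" by (rule eq_iff_diff_eq_0[THEN iffD2])
      then have "f \<in> invariants p (insert z S)" using 0 unfolding invariants_def by blast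
      then show ?case using ins by blast
    next
      case (Suc d)
      have "shift g f - f \<in> P" if g: "g \<in> carrier G" for g
      proof (rule Suc.IH)
        show "shift g f - f \<in> invariants p S" by (rule diff_in[OF Suc.prems(1) g])
        have "shift z (shift g f) = shift g (shift z f)"
          using commute[OF _ z g] Suc.prems(1) sub by blast
        then have "shift z (shift g f - f) - (shift g f - f) = shift g (shift z f - f) - (shift z f - f)"
          by (simp add: shift_diff)
        then show "shift z (shift g f - f) - (shift g f - f) \<in> polynomials d"
          using Suc.prems(2) g unfolding polynomials_Suc_iff by metis
      qed
      then show ?case using polynomials_closed[OF fin diff_tf[OF Suc.prems(1)]] by (simp add: P_def)
    qed
    have nil: "f \<in> P" if "f \<in> invariants p S" "((\<lambda>f. shift z f - f) ^^ m) f = 0" for f m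
      using that
    proof (induction m arbitrary: f)
      case 0
      then have "f = 0" by (simp only: funpow_0)
      then have "f \<in> polynomials 0" by (simp only: polynomials.simps singleton_iff)
      then show ?case unfolding P_def by blast
    next
      case (Suc m)
      have "shift z f - f \<in> P"
      proof (rule Suc.IH)
        show "shift z f - f \<in> invariants p S" using Suc.prems(1) z Y by (intro diff_in) auto
        show "((\<lambda>f. shift z f - f) ^^ m) (shift z f - f) = 0"
          using Suc.prems(2) by (simp only: funpow_Suc_right comp_apply)
      qed
      then show ?case using lift[OF Suc.prems(1)] by (auto simp: P_def)
    qed
    show ?thesis
    proof
      fix f assume f: "f \<in> invariants p S"
      have zG: "z \<in> carrier G" using z Y by blast
      have "((\<lambda>f. shift z f - f) ^^ (p ^ k)) f = (shift z ^^ (p ^ k)) f - f"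
        using f by (intro freshman_power_prime_power p shift_add) (simp add: invariants_def)
      \<comment> \<open>The power of \<open>z\<close> lies in \<open>Z\<close>, under which \<open>f\<close> is invariant.\<close>
      also have "(shift z ^^ (p ^ k)) f = f"
        using f S expo[OF z] zG by (auto simp: shift_funpow invariants_def)
      also have "f - f = 0" by (rule diff_self)
      finally show "f \<in> P" by (rule nil[OF f])
    qed
  qed
  have "finite Y" using fin Y by (rule rev_finite_subset)
  have "invariants p (Z \<union> (Y - T)) \<subseteq> P" if "finite T" "T \<subseteq> Y" for T
    using that
  proof (induction T rule: finite_induct)
    case empty
    have "Z \<union> (Y - {}) = Y" using Z by blast
    then show ?case using Y_poly by (simp only: P_def)
  next
    case (insert z T)
    show ?case
    proof (rule drop)
      have "invariants p (insert z (Z \<union> (Y - insert z T))) \<subseteq> invariants p (Z \<union> (Y - T))"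
        by (rule invariants_mono) blast
      also have "\<dots> \<subseteq> P" using insert by blast
      finally show "invariants p (insert z (Z \<union> (Y - insert z T))) \<subseteq> P" .
    qed (use insert.prems Z in blast)+
  qed
  from this[OF \<open>finite Y\<close> order_refl] show ?thesis by (simp add: P_def)
qed

end

section \<open>Central series relative to a normal subgroup\<close>

context group
begin

text \<open>The preimages in \<open>G\<close> of the upper central series of the quotient \<open>G Mod N\<close>. Staying inside \<open>G\<close> avoids
transporting nilpotency to quotients.\<close>

primrec upper_central_series :: "'a set \<Rightarrow> nat \<Rightarrow> 'a set" where
  "upper_central_series N 0 = N"
| "upper_central_series N (Suc k) =
     {x \<in> carrier G. \<forall>y\<in>carrier G. commutator x y \<in> upper_central_series N k}"

lemma normal_next_central:
  assumes "N \<lhd> G"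
  shows "{x \<in> carrier G. \<forall>y\<in>carrier G. commutator x y \<in> N} \<lhd> G" (is "?Z \<lhd> G")
proof -
  interpret N: normal N G by fact
  have mem: "x \<in> carrier G" if "x \<in> N" for x using that by (rule N.mem_carrier)
  show ?thesis
    unfolding normal_inv_iff
  proof (intro conjI ballI subgroupI)
    show "?Z \<subseteq> carrier G" by auto
    have "\<one> \<in> ?Z" by simp
    then show "?Z \<noteq> {}" by blast
  next
    fix x assume "x \<in> ?Z"
    then have x: "x \<in> carrier G" "\<And>y. y \<in> carrier G \<Longrightarrow> commutator x y \<in> N" by auto
    have "commutator (inv x) y \<in> N" if y: "y \<in> carrier G" for y
    proof -
      have "commutator (inv x) y = inv x \<otimes> inv (commutator x y) \<otimes> x"
        using x(1) y by (simp add: group_word_simps)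
      then show ?thesis using N.inv_op_closed1[OF x(1) N.m_inv_closed[OF x(2)[OF y]]] by simp
    qed
    then show "inv x \<in> ?Z" using x by simp
  next
    fix x x' assume "x \<in> ?Z" "x' \<in> ?Z"
    then have x: "x \<in> carrier G" "\<And>y. y \<in> carrier G \<Longrightarrow> commutator x y \<in> N"
      and x': "x' \<in> carrier G" "\<And>y. y \<in> carrier G \<Longrightarrow> commutator x' y \<in> N" by auto
    have "commutator (x \<otimes> x') y \<in> N" if y: "y \<in> carrier G" for y
    proof -
      have "commutator (x \<otimes> x') y = (x \<otimes> commutator x' y \<otimes> inv x) \<otimes> commutator x y"
        using x(1) x'(1) y by (simp add: group_word_simps)
      then show ?thesis using N.m_closed[OF N.inv_op_closed2[OF x(1) x'(2)[OF y]] x(2)[OF y]] by simp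
    qed
    then show "x \<otimes> x' \<in> ?Z" using x x' by simp
  next
    fix g x assume g: "g \<in> carrier G" and "x \<in> ?Z"
    then have x: "x \<in> carrier G" "\<And>y. y \<in> carrier G \<Longrightarrow> commutator x y \<in> N" by auto
    have "commutator (g \<otimes> x \<otimes> inv g) y \<in> N" if y: "y \<in> carrier G" for y
    proof -
      have "commutator (g \<otimes> x \<otimes> inv g) y = g \<otimes> commutator x (inv g \<otimes> y \<otimes> g) \<otimes> inv g"
        using x(1) g y by (simp add: group_word_simps)
      then show ?thesis using N.inv_op_closed2[OF g x(2)[of "inv g \<otimes> y \<otimes> g"]] g y by simp
    qed
    then show "g \<otimes> x \<otimes> inv g \<in> ?Z" using x g by simp
  qed
qed

lemma normal_upper_central_series: "N \<lhd> G \<Longrightarrow> upper_central_series N k \<lhd> G"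
  by (induction k) (auto intro: normal_next_central)

lemma upper_central_series_asc:
  assumes "N \<lhd> G"
  shows "upper_central_series N k \<subseteq> upper_central_series N (Suc k)"
proof
  interpret Z: normal "upper_central_series N k" G by (rule normal_upper_central_series) fact
  fix x assume x: "x \<in> upper_central_series N k"
  have xG: "x \<in> carrier G" using x by (rule Z.mem_carrier)
  have "commutator x y \<in> upper_central_series N k" if y: "y \<in> carrier G" for y
  proof -
    have "commutator x y = x \<otimes> (y \<otimes> inv x \<otimes> inv y)" using xG y by (simp add: m_assoc)
    then show ?thesis
      using Z.m_closed[OF x Z.inv_op_closed2[OF y Z.m_inv_closed[OF x]]] by simp
  qed
  then show "x \<in> upper_central_series N (Suc k)" using xG by simp
qed

lemma upper_central_series_top:
  assumes c: "lower_central_series G c = {\<one>}" and N: "N \<lhd> G"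
  shows "upper_central_series N c = carrier G"
proof -
  interpret N: normal N G by fact
  have "j \<le> c \<Longrightarrow> lower_central_series G (c - j) \<subseteq> upper_central_series N j" for j
  proof (induction j)
    case 0
    then show ?case using c by simp
  next
    case (Suc j)
    have "commutator x y \<in> upper_central_series N j"
      if "x \<in> lower_central_series G (c - Suc j)" "y \<in> carrier G" for x y
    proof -
      have "commutator x y \<in> lower_central_series G (Suc (c - Suc j))"
        using that by (auto intro!: generate.incl)
      moreover have "Suc (c - Suc j) = c - j" using Suc.prems by simp
      ultimately show ?thesis using Suc.IH Suc.prems by auto
    qed
    then show ?case using Suc.prems(1) lower_central_series_subset[OF is_group] by auto
  qed
  from this[of c] show ?thesis
    using normal_imp_subgroup[OF normal_upper_central_series[OF N, of c]] by (auto dest: subgroup.mem_carrier)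
qed

lemma mem_normal_iff_coset_eq_one:
  assumes "N \<lhd> G" "x \<in> carrier G"
  shows "x \<in> N \<longleftrightarrow> N #> x = \<one>\<^bsub>G Mod N\<^esub>"
  using coset_join1[of N x] coset_join2[of x N] normal_imp_subgroup assms by (auto simp: FactGroup_def)

lemma group_hom_coset:
  assumes "N \<lhd> G"
  shows "group_hom G (G Mod N) (\<lambda>x. N #> x)"
  using assms normal.factorgroup_is_group normal.r_coset_hom_Mod is_group
  by (auto simp: group_hom_def group_hom_axioms_def)

lemma cosets_commute:
  assumes N: "N \<lhd> G" and xy: "x \<in> carrier G" "y \<in> carrier G" and comm: "commutator x y \<in> N"
  shows "(N #> x) \<otimes>\<^bsub>G Mod N\<^esub> (N #> y) = (N #> y) \<otimes>\<^bsub>G Mod N\<^esub> (N #> x)"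
proof -
  interpret pi: group_hom G "G Mod N" "\<lambda>x. N #> x" by (rule group_hom_coset[OF N])
  have c: "commutator x y \<in> carrier G" using xy by simp
  have "N #> (x \<otimes> y) = N #> (commutator x y \<otimes> (y \<otimes> x))" by (simp only: commutator_mult[OF xy])
  also have "\<dots> = (N #> commutator x y) \<otimes>\<^bsub>G Mod N\<^esub> (N #> (y \<otimes> x))"
    using c xy by (intro pi.hom_mult) simp_all
  also have "\<dots> = N #> (y \<otimes> x)"
    unfolding mem_normal_iff_coset_eq_one[OF N c, THEN iffD1, OF comm]
    using xy by (intro pi.H.l_one pi.hom_closed) simp
  finally show ?thesis using xy by (simp only: pi.hom_mult)
qed

text \<open>Modulo \<open>N\<close> the first term of the series is abelian, so its elements of order dividing \<open>m\<close> form a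
subgroup; a subgroup between \<open>N\<close> and the centre modulo \<open>N\<close> is automatically normal.\<close>

lemma normal_power_kernel:
  assumes N: "N \<lhd> G"
  shows "{x \<in> upper_central_series N 1. x [^] (m::nat) \<in> N} \<lhd> G"
proof -
  interpret N: normal N G by fact
  define Z1 where "Z1 = upper_central_series N 1"
  interpret Z: normal Z1 G unfolding Z1_def by (rule normal_upper_central_series[OF N])
  interpret pi: group_hom G "G Mod N" "\<lambda>x. N #> x" by (rule group_hom_coset[OF N])
  have comm: "commutator x y \<in> N" if "x \<in> Z1" "y \<in> carrier G" for x y
    using that unfolding Z1_def One_nat_def upper_central_series.simps by blast
  have NZ1: "N \<subseteq> Z1"
    using upper_central_series_asc[OF N, of 0]
    unfolding Z1_def One_nat_def upper_central_series.simps(1) .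
  define T where "T = {x \<in> Z1. x [^] m \<in> N}"
  have NT: "N \<subseteq> T"
  proof
    fix x assume x: "x \<in> N"
    have "x [^] m \<in> N" by (induction m) (use x in auto)
    then show "x \<in> T" using NZ1 x by (auto simp: T_def)
  qed
  have sub: "subgroup T G"
  proof (rule subgroupI)
    show "T \<subseteq> carrier G" using Z.subset by (auto simp: T_def)
    show "T \<noteq> {}" using NT N.one_closed by blast
  next
    fix x assume "x \<in> T"
    then have x: "x \<in> Z1" "x [^] m \<in> N" by (simp_all add: T_def)
    have "inv x [^] m = inv (x [^] m)" by (rule nat_pow_inv[OF Z.mem_carrier[OF x(1)]])
    then show "inv x \<in> T" using Z.m_inv_closed[OF x(1)] N.m_inv_closed[OF x(2)] by (simp add: T_def)
  next
    fix x y assume "x \<in> T" "y \<in> T"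
    then have x: "x \<in> Z1" "x [^] m \<in> N"
      and y: "y \<in> Z1" "y [^] m \<in> N" by (simp_all add: T_def)
    have xG: "x \<in> carrier G" "y \<in> carrier G" using x(1) y(1) by (auto dest: Z.mem_carrier)
    have "(N #> x) \<otimes>\<^bsub>G Mod N\<^esub> (N #> y) = (N #> y) \<otimes>\<^bsub>G Mod N\<^esub> (N #> x)"
      using comm x(1) xG by (intro cosets_commute N) simp_all
    then have "((N #> x) \<otimes>\<^bsub>G Mod N\<^esub> (N #> y)) [^]\<^bsub>G Mod N\<^esub> m =
        (N #> x) [^]\<^bsub>G Mod N\<^esub> m \<otimes>\<^bsub>G Mod N\<^esub> (N #> y) [^]\<^bsub>G Mod N\<^esub> m"
      using xG by (intro pi.H.pow_mult_distrib) simp_all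
    also have "(N #> x) [^]\<^bsub>G Mod N\<^esub> m = \<one>\<^bsub>G Mod N\<^esub>"
      using x(2) mem_normal_iff_coset_eq_one[OF N nat_pow_closed[OF xG(1)]]
      by (simp only: pi.hom_nat_pow[OF xG(1)])
    also have "(N #> y) [^]\<^bsub>G Mod N\<^esub> m = \<one>\<^bsub>G Mod N\<^esub>"
      using y(2) mem_normal_iff_coset_eq_one[OF N nat_pow_closed[OF xG(2)]]
      by (simp only: pi.hom_nat_pow[OF xG(2)])
    also have "\<one>\<^bsub>G Mod N\<^esub> \<otimes>\<^bsub>G Mod N\<^esub> \<one>\<^bsub>G Mod N\<^esub> = \<one>\<^bsub>G Mod N\<^esub>"
      by (rule pi.H.l_one[OF pi.H.one_closed])
    finally have "N #> ((x \<otimes> y) [^] m) = \<one>\<^bsub>G Mod N\<^esub>"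
      using xG by (simp only: pi.hom_nat_pow pi.hom_mult m_closed)
    then have "(x \<otimes> y) [^] m \<in> N"
      using mem_normal_iff_coset_eq_one[OF N nat_pow_closed[OF m_closed[OF xG]]] by blast
    then show "x \<otimes> y \<in> T" using Z.m_closed[OF x(1) y(1)] by (simp add: T_def)
  qed
  interpret T: subgroup T G by (rule sub)
  have "T \<lhd> G"
    unfolding normal_inv_iff
  proof (intro conjI sub ballI)
    fix g x assume g: "g \<in> carrier G" and x: "x \<in> T"
    have xG: "x \<in> carrier G" using x by (rule T.mem_carrier)
    have "x \<in> Z1" using x unfolding T_def by blast
    then have "inv (commutator x g) \<in> T" using comm[OF _ g] NT by (intro T.m_inv_closed) blast
    moreover have "g \<otimes> x \<otimes> inv g = inv (commutator x g) \<otimes> x"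
      using xG g by (simp add: group_word_simps)
    ultimately show "g \<otimes> x \<otimes> inv g \<in> T" using T.m_closed[OF _ x] by metis
  qed
  then show ?thesis by (simp only: T_def Z1_def)
qed

text \<open>The exponent of the centre bounds the exponents of all upper central factors: if \<open>x\<close> lies in the
\<open>(i + 2)\<close>-nd term, then modulo the \<open>i\<close>-th term its commutators are central, whence
the commutator of \<open>x ^ q\<close> with \<open>y\<close> is the \<open>q\<close>-th power of the commutator of \<open>x\<close> with \<open>y\<close>, which lies in the
\<open>i\<close>-th term by induction.\<close>

lemma power_descends:
  assumes N: "N \<lhd> G"
    and base: "\<And>x. x \<in> upper_central_series N 1 \<Longrightarrow> x [^] (q::nat) \<in> N"
  shows "x \<in> upper_central_series N (Suc i) \<Longrightarrow> x [^] q \<in> upper_central_series N i"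
proof (induction i arbitrary: x)
  case 0
  then show ?case using base[of x] by simp
next
  case (Suc i)
  define Z where "Z = upper_central_series N i"
  have Z: "Z \<lhd> G" unfolding Z_def by (rule normal_upper_central_series) fact
  interpret pi: group_hom G "G Mod Z" "\<lambda>x. Z #> x" by (rule group_hom_coset) fact
  have xG: "x \<in> carrier G" using Suc.prems by simp
  have "commutator (x [^] q) y \<in> Z" if y: "y \<in> carrier G" for y
  proof -
    define c where "c = commutator x y"
    have c: "c \<in> upper_central_series N (Suc i)" using Suc.prems y by (simp add: c_def)
    have cG: "c \<in> carrier G" using xG y by (simp add: c_def)
    have "commutator c x \<in> Z" using c xG by (simp add: Z_def)
    then have comm: "(Z #> c) \<otimes>\<^bsub>G Mod Z\<^esub> (Z #> x) = (Z #> x) \<otimes>\<^bsub>G Mod Z\<^esub> (Z #> c)"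
      using cG xG by (intro cosets_commute Z)
    have hom: "Z #> commutator u y = pi.H.commutator (Z #> u) (Z #> y)" if u: "u \<in> carrier G" for u
      using u y by (simp only: pi.hom_mult pi.hom_inv m_closed inv_closed)
    have pi_in: "Z #> x \<in> carrier (G Mod Z)" "Z #> y \<in> carrier (G Mod Z)"
      by (rule pi.hom_closed, fact)+
    have "Z #> commutator (x [^] q) y = pi.H.commutator ((Z #> x) [^]\<^bsub>G Mod Z\<^esub> q) (Z #> y)"
      by (simp only: hom[OF nat_pow_closed[OF xG]] pi.hom_nat_pow[OF xG])
    also have "\<dots> = (Z #> c) [^]\<^bsub>G Mod Z\<^esub> q"
      using pi.H.commutator_pow[OF pi_in] comm unfolding c_def hom[OF xG] by blast
    also have "\<dots> = Z #> (c [^] q)"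
      by (rule pi.hom_nat_pow[OF cG, symmetric])
    also have "\<dots> = \<one>\<^bsub>G Mod Z\<^esub>"
      using Suc.IH[OF c] mem_normal_iff_coset_eq_one[OF Z nat_pow_closed[OF cG]] by (simp only: Z_def)
    finally show ?thesis using xG y by (simp add: mem_normal_iff_coset_eq_one[OF Z])
  qed
  then show ?case using xG by (simp add: Z_def)
qed

text \<open>Choose \<open>N\<close> maximal among the normal subgroups that avoid \<open>g\<close>, and let \<open>p\<close> be a prime divisor of the order
\<open>d\<close> of \<open>g\<close> modulo \<open>N\<close>. Write the order of \<open>G\<close> as \<open>p ^ k * m\<close> with \<open>m\<close> prime to \<open>p\<close>. The elements \<open>x\<close> that are central
modulo \<open>N\<close> with \<open>x ^ m \<in> N\<close> form a normal subgroup containing \<open>N\<close> but not \<open>g\<close>, because \<open>d\<close> does not divide \<open>m\<close>. By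
maximality this subgroup is \<open>N\<close>, and it contains the \<open>p ^ k\<close>-th power of every element that is central
modulo \<open>N\<close>.\<close>

lemma ex_prime_power_section:
  assumes fin: "finite (carrier G)" and g: "g \<in> carrier G" "g \<noteq> \<one>"
  obtains N p k where "N \<lhd> G" "g \<notin> N" "prime p" "p dvd order G"
    "\<And>i x. x \<in> upper_central_series N (Suc i) \<Longrightarrow> x [^] (p ^ k) \<in> upper_central_series N i"
proof -
  have "finite {N. N \<lhd> G \<and> g \<notin> N}"
    by (rule finite_subset[of _ "Pow (carrier G)"])
      (use fin in \<open>auto dest!: normal_imp_subgroup dest: subgroup.mem_carrier\<close>)
  moreover have "{N. N \<lhd> G \<and> g \<notin> N} \<noteq> {}" using one_is_normal g by blast
  ultimately obtain N where N: "N \<lhd> G" "g \<notin> N"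
    and max: "\<And>L. L \<lhd> G \<Longrightarrow> g \<notin> L \<Longrightarrow> N \<subseteq> L \<Longrightarrow> L = N"
    using finite_has_maximal[of "{N. N \<lhd> G \<and> g \<notin> N}"] by blast
  interpret N: normal N G by fact
  define d where "d = (LEAST m. m > 0 \<and> g [^] (m::nat) \<in> N)"
  have ord: "order G > 0" using fin by (simp add: order_gt_0_iff_finite)
  have "order G > 0 \<and> g [^] order G \<in> N" using ord g by (simp add: pow_order_eq_1)
  then have d: "d > 0" "g [^] d \<in> N" and d_least: "\<And>m. m > 0 \<Longrightarrow> g [^] m \<in> N \<Longrightarrow> d \<le> m"
    unfolding d_def by (metis (mono_tags, lifting) LeastI Least_le)+
  have pow_in: "(g [^] d) [^] j \<in> N" for j :: nat
    by (induction j) (use d(2) in auto)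
  have d_dvd: "d dvd m" if m: "g [^] m \<in> N" for m
  proof -
    have a: "(g [^] d) [^] (m div d) \<in> N" by (rule pow_in)
    have "g [^] m = g [^] (d * (m div d) + m mod d)" by simp
    also have "\<dots> = (g [^] d) [^] (m div d) \<otimes> g [^] (m mod d)"
      using g by (simp add: nat_pow_mult nat_pow_pow del: mult_div_mod_eq)
    finally have "g [^] (m mod d) = inv ((g [^] d) [^] (m div d)) \<otimes> g [^] m"
      using g by (simp add: inv_mult_cancel)
    then have "g [^] (m mod d) \<in> N" using N.m_closed[OF N.m_inv_closed[OF a] m] by simp
    then have "m mod d = 0" using d_least[of "m mod d"] d(1) by (metis gr0I mod_less_divisor not_less)
    then show ?thesis by (simp add: dvd_eq_mod_eq_0)
  qed
  have "d \<noteq> 1" using d(2) N(2) g by auto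
  then obtain p where p: "prime p" "p dvd d" by (meson prime_factor_nat)
  define k where "k = multiplicity p (order G)"
  obtain m where m: "order G = p ^ k * m" "\<not> p dvd m"
    unfolding k_def using multiplicity_decompose'[of "order G" p] ord p(1) by (metis neq0_conv not_prime_unit)
  have base: "x [^] (p ^ k) \<in> N" if x: "x \<in> upper_central_series N 1" for x
  proof -
    define T where "T = {x \<in> upper_central_series N 1. x [^] m \<in> N}"
    interpret Z: normal "upper_central_series N 1" G by (rule normal_upper_central_series) fact
    have xG: "x \<in> carrier G" using x by (rule Z.mem_carrier)
    have pow: "x [^] j \<in> upper_central_series N 1" for j :: nat
      by (induction j) (use Z.one_closed Z.m_closed x in \<open>auto simp del: upper_central_series.simps\<close>)
    have "(x [^] (p ^ k)) [^] m = \<one>"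
      unfolding nat_pow_pow[OF xG] m(1)[symmetric] by (rule pow_order_eq_1[OF xG])
    then have "(x [^] (p ^ k)) [^] m \<in> N" by (simp only: N.one_closed)
    then have "x [^] (p ^ k) \<in> T" unfolding T_def using pow by blast
    moreover have "T = N"
    proof (rule max)
      show "T \<lhd> G" unfolding T_def by (rule normal_power_kernel[OF N(1)])
      have "\<not> d dvd m" using p(2) m(2) dvd_trans by blast
      then show "g \<notin> T" unfolding T_def using d_dvd by blast
      have "N \<subseteq> upper_central_series N 1"
        using upper_central_series_asc[OF N(1), of 0]
        unfolding One_nat_def upper_central_series.simps(1) .
      moreover have "y [^] m \<in> N" if "y \<in> N" for y by (induction m) (use that in auto)
      ultimately show "N \<subseteq> T" unfolding T_def by blast
    qed
    ultimately show ?thesis by simp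
  qed
  have "p dvd order G" using p(2) d_dvd[of "order G"] g by (auto simp: pow_order_eq_1 intro: dvd_trans)
  with N p(1) show thesis using that power_descends[OF N(1) base] by blast
qed

end

section \<open>Embedding nilpotent groups\<close>

context group
begin

text \<open>Right translation by an element of \<open>N\<close> preserves both \<open>N\<close> and its complement.\<close>

lemma indicator_in_invariants:
  assumes N: "N \<lhd> G" and u: "nat_scale p u = 0" and p: "p dvd order G"
  shows "(\<lambda>x. if x \<in> N then u else 0) \<in> invariants p N"
proof -
  interpret N: normal N G by fact
  let ?f = "\<lambda>x. if x \<in> N then u else (0 :: rat_circle)"
  have "nat_scale m ?f = 0" if "nat_scale m u = 0" for m
    using that unfolding nat_scale_fun by (auto simp: fun_eq_iff)
  moreover have "nat_scale (order G) u = 0" by (rule nat_scale_eq_0_dvd[OF u p])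
  moreover have "shift s ?f = ?f" if s: "s \<in> N" for s
  proof
    fix x
    show "shift s ?f x = ?f x"
    proof (cases "x \<in> carrier G")
      case True
      have "x = (x \<otimes> s) \<otimes> inv s" using True N.mem_carrier[OF s] by (simp add: m_assoc)
      then have "x \<in> N" if "x \<otimes> s \<in> N"
        using N.m_closed[OF that N.m_inv_closed[OF s]] by metis
      then have "x \<otimes> s \<in> N \<longleftrightarrow> x \<in> N" using N.m_closed[OF _ s] by blast
      then show ?thesis using True by (simp only: shift_def if_True)
    next
      case False
      then have "x \<notin> N" using N.mem_carrier by blast
      then show ?thesis using False by (simp only: shift_def if_False)
    qed
  qed
  moreover have "?f x = 0" if "x \<notin> carrier G" for x
  proof -
    have "x \<notin> N" using that N.mem_carrier by blast
    then show ?thesis by (rule if_not_P)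
  qed
  ultimately show ?thesis unfolding invariants_def torsion_functions_def using u by blast
qed

text \<open>By nilpotency the upper central series relative to \<open>N\<close> reaches \<open>G\<close>. Functions invariant
under \<open>G\<close> are constant, hence polynomial, and the property descends along the series to the
\<open>N\<close>-invariant functions.\<close>

lemma polynomials_separate:
  assumes fin: "finite (carrier G)" and nil: "lower_central_series G c = {\<one>}"
    and g: "g \<in> carrier G" "g \<noteq> \<one>"
  shows "\<exists>f\<in>(\<Union>k. polynomials k). shift g f \<noteq> f"
proof -
  obtain N p k where N: "N \<lhd> G" "g \<notin> N" and p: "prime p" "p dvd order G"
    and expo: "\<And>i x. x \<in> upper_central_series N (Suc i) \<Longrightarrow> x [^] (p ^ k) \<in> upper_central_series N i"
    using ex_prime_power_section[OF fin g] by blast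
  interpret N: normal N G by fact
  have "j \<le> c \<Longrightarrow> invariants p (upper_central_series N (c - j)) \<subseteq> (\<Union>k. polynomials k)" for j
  proof (induction j)
    case 0
    have "f \<in> polynomials 1" if f: "f \<in> invariants p (carrier G)" for f
    proof -
      have "shift x f - f = 0" if "x \<in> carrier G" for x
        using f that by (simp add: invariants_def)
      then show ?thesis
        using f unfolding One_nat_def polynomials_Suc_iff polynomials.simps(1) invariants_def by blast
    qed
    then show ?case using upper_central_series_top[OF nil N(1)] by auto
  next
    case (Suc j)
    define i where "i = c - Suc j"
    have i: "Suc i = c - j" using Suc.prems by (simp add: i_def)
    interpret Y: normal "upper_central_series N (Suc i)" G by (rule normal_upper_central_series[OF N(1)])
    have "invariants p (upper_central_series N i) \<subseteq> (\<Union>k. polynomials k)"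
    proof (rule invariants_section_polynomial[OF fin p(1) _ Y.subset _ expo])
      show "upper_central_series N i \<subseteq> upper_central_series N (Suc i)"
        by (rule upper_central_series_asc[OF N(1)])
      show "invariants p (upper_central_series N (Suc i)) \<subseteq> (\<Union>k. polynomials k)"
        unfolding i using Suc by simp
      fix y x assume y: "y \<in> upper_central_series N (Suc i)" and x: "x \<in> carrier G"
      have yG: "y \<in> carrier G" by (rule Y.mem_carrier[OF y])
      have "commutator (inv y) (inv x) \<in> upper_central_series N i"
        using Y.m_inv_closed[OF y] x unfolding upper_central_series.simps by blast
      moreover have "y \<otimes> x = x \<otimes> y \<otimes> commutator (inv y) (inv x)"
        by (rule commute_up_to_commutator[OF x yG])
      ultimately show "\<exists>z\<in>upper_central_series N i. y \<otimes> x = x \<otimes> y \<otimes> z" by blast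
    qed
    then show ?case by (simp only: i_def)
  qed
  from this[of c] have poly: "invariants p N \<subseteq> (\<Union>k. polynomials k)" by simp
  obtain u :: rat_circle where u: "u \<noteq> 0" "nat_scale p u = 0"
    using ex_rat_circle_order_prime prime_gt_1_nat[OF p(1)] by blast
  define f where "f = (\<lambda>x. if x \<in> N then u else 0)"
  have "f \<in> invariants p N" unfolding f_def by (rule indicator_in_invariants[OF N(1) u(2) p(2)])
  moreover have "shift g f \<one> \<noteq> f \<one>"
    using u(1)[symmetric] N(2)
    by (simp only: shift_def f_def one_closed l_one[OF g(1)] N.one_closed if_True if_False not_False_eq_True)
  then have "shift g f \<noteq> f" by metis
  ultimately show ?thesis using poly by blast
qed

lemma filtered_group_polynomials:
  assumes fin: "finite (carrier G)" and top: "\<And>k. polynomials k \<subseteq> polynomials c"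
  shows "filtered_group polynomials c"
proof (rule filtered_group.intro)
  show "finite (polynomials c)"
    using finite_subset[OF polynomials_subset finite_torsion_functions[OF fin]] .
  show "0 \<in> polynomials k" for k by (rule polynomials_zero)
  show "f + h \<in> polynomials k" if "f \<in> polynomials k" "h \<in> polynomials k" for k f h
    using that by (rule polynomials_add)
  show "- f \<in> polynomials k" if "f \<in> polynomials k" for k f
    using that by (rule polynomials_uminus)
  show "polynomials k \<subseteq> polynomials (Suc k)" for k by (rule polynomials_asc)
  show "polynomials k \<subseteq> polynomials c" for k by (rule top)
  show "polynomials 0 = {0}" by (rule polynomials.simps(1))
qed

text \<open>The embedding sends \<open>g\<close> to its difference operator on polynomial functions, that is, to
\<open>T - 1\<close> where \<open>T\<close> is translation by \<open>g\<close>; the adjoint multiplication is the one for which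
\<open>T - 1\<close> depends multiplicatively on \<open>T\<close>.\<close>

lemma nilpotent_embeds_in_IYB:
  assumes fin: "finite (carrier G)" and nil: "lower_central_series G d = {\<one>}"
  obtains H :: "(nat \<Rightarrow> nat) monoid" and e
  where "IYB_group H" "nilpotent_group H" "e \<in> hom G H" "inj_on e (carrier G)"
proof -
  obtain c where c: "\<And>k. polynomials k \<subseteq> polynomials c"
    by (rule polynomials_stabilise[OF fin]) blast
  interpret filtered_group polynomials c by (rule filtered_group_polynomials[OF fin c])
  interpret R: nilpotent_ring lowering "(\<circ>)" c by (rule nilpotent_ring_lowering)
  define \<iota> where "\<iota> g = (\<lambda>f. if f \<in> polynomials c then shift g f - f else 0)" for g
  have diff_in: "shift g f - f \<in> polynomials (i - Suc 0)" if "f \<in> polynomials i" "g \<in> carrier G" for f i g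
  proof (cases i)
    case 0
    then have "f = 0" using that(1) bot by blast
    then show ?thesis by (simp only: shift_zero diff_zero polynomials_zero)
  next
    case (Suc j)
    then show ?thesis
      using that polynomials_Suc_iff[of f j] by (simp only: diff_Suc_Suc minus_nat.diff_0)
  qed
  have iota_eq: "\<iota> g f = shift g f - f" if "f \<in> polynomials c" for g f
    using that by (simp only: \<iota>_def if_True)
  have iota_off: "\<iota> g f = 0" if "f \<notin> polynomials c" for g f
    using that by (simp only: \<iota>_def if_False)
  have iota_in: "\<iota> g \<in> lowering 0" if g: "g \<in> carrier G" for g
  proof -
    have "\<iota> g (f + h) = \<iota> g f + \<iota> g h" if "f \<in> polynomials c" "h \<in> polynomials c" for f h
      unfolding iota_eq[OF that(1)] iota_eq[OF that(2)] iota_eq[OF add[OF that]] shift_add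
      by (simp only: algebra_simps)
    moreover have "\<iota> g f \<in> polynomials (i - Suc 0)" if f: "f \<in> polynomials i" for f i
      unfolding iota_eq[OF subsetD[OF c f]] by (rule diff_in[OF f g])
    ultimately show ?thesis unfolding lowering_def using iota_off by blast
  qed
  have adj_apply: "R.adj r s f = r f + s f + r (s f)" for r s f
    by (simp add: R.adj_def)
  have hom: "\<iota> (g \<otimes> h) = R.adj (\<iota> g) (\<iota> h)" if g: "g \<in> carrier G" and h: "h \<in> carrier G" for g h
  proof
    fix f
    show "\<iota> (g \<otimes> h) f = R.adj (\<iota> g) (\<iota> h) f"
    proof (cases "f \<in> polynomials c")
      case True
      \<comment> \<open>The next lines verify the identity \<open>S T - 1 = (S - 1) + (T - 1) + (S - 1) (T - 1)\<close> for translations \<open>S\<close> and \<open>T\<close>.\<close>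
      have "shift h f - f \<in> polynomials c" using c diff_in[OF True h] by blast
      then have "R.adj (\<iota> g) (\<iota> h) f =
          shift g f - f + (shift h f - f) + (shift g (shift h f - f) - (shift h f - f))"
        by (simp only: adj_apply iota_eq[OF True] iota_eq)
      also have "\<dots> = shift g (shift h f) - f" by (simp add: shift_diff)
      finally show ?thesis by (simp only: iota_eq[OF True] shift_mult[OF g h])
    next
      case False
      have "\<iota> g 0 = 0" by (rule lowering_zero[OF iota_in[OF g]])
      then show ?thesis
        by (simp only: adj_apply iota_off[OF False] add_0_left)
    qed
  qed
  have iota_hom: "\<iota> \<in> hom G R.adj_grp"
  proof (rule homI)
    show "\<iota> g \<in> carrier R.adj_grp" if "g \<in> carrier G" for g
      unfolding partial_object.select_convs by (rule iota_in[OF that])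
    show "\<iota> (g \<otimes> h) = \<iota> g \<otimes>\<^bsub>R.adj_grp\<^esub> \<iota> h" if "g \<in> carrier G" "h \<in> carrier G" for g h
      unfolding monoid.select_convs by (rule hom[OF that])
  qed
  have "g = \<one>" if g: "g \<in> carrier G" and eq: "\<iota> g = 0" for g
  proof (rule ccontr)
    assume "g \<noteq> \<one>"
    then obtain k f where f: "f \<in> polynomials k" "shift g f \<noteq> f"
      using polynomials_separate[OF fin nil g] by blast
    have "\<iota> g f = 0" unfolding eq by (rule zero_fun_apply)
    then have "shift g f - f = 0" unfolding iota_eq[OF subsetD[OF c f(1)]] .
    with f(2) show False unfolding right_minus_eq by blast
  qed
  then have inj: "inj_on \<iota> (carrier G)"
    unfolding inj_on_one_iff'[OF iota_hom is_group R.group_adj] monoid.select_convs by blast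
  obtain H :: "(nat \<Rightarrow> nat) monoid" and h
    where H: "IYB_group H" "nilpotent_group H" and h: "h \<in> iso R.adj_grp H"
    using R.nilpotent_IYB_copy by blast
  have h_hom: "h \<in> hom R.adj_grp H" and h_inj: "inj_on h (lowering 0)"
    using h unfolding iso_def bij_betw_def by simp_all
  have "inj_on h (\<iota> ` carrier G)" by (rule inj_on_subset[OF h_inj]) (use iota_in in blast)
  then show thesis
    by (intro that[OF H, of "h \<circ> \<iota>"] Group.hom_compose[OF iota_hom h_hom] comp_inj_on[OF inj])
qed

end

theorem corollary3p7:
  fixes G :: "('a, 'b) monoid_scheme"
  assumes "finite (carrier G)" and "nilpotent_group G"
  shows "\<exists>(H :: (nat \<Rightarrow> nat) monoid) K.
           IYB_group H \<and> nilpotent_group H \<and> subgroup K H \<and> G \<cong> H\<lparr>carrier := K\<rparr>"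
proof -
  interpret group G using assms(2) by (simp add: nilpotent_group_def)
  obtain d where "lower_central_series G d = {\<one>\<^bsub>G\<^esub>}"
    using assms(2) unfolding nilpotent_group_def by blast
  then obtain H :: "(nat \<Rightarrow> nat) monoid" and e
    where H: "IYB_group H" "nilpotent_group H" and e: "e \<in> hom G H" "inj_on e (carrier G)"
    using nilpotent_embeds_in_IYB[OF assms(1)] by blast
  interpret e: group_hom G H e
    using e(1) H(1) is_group by (simp add: group_hom_def group_hom_axioms_def IYB_group_def)
  have "e \<in> iso G (H\<lparr>carrier := e ` carrier G\<rparr>)"
    using e by (auto simp: iso_def bij_betw_def hom_def)
  then have "G \<cong> H\<lparr>carrier := e ` carrier G\<rparr>" by (rule is_isoI)
  with H e.img_is_subgroup show ?thesis by blast
qed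

end
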